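(* Let $s \ge 0$ be an integer and $M$ a matroid. Then either $M$ has a $U_{s,2s}$-minor, or $M$ has an $sU_{1,2}$-minor, or $M$ has a minor $N$ such that $|E(M)| - |E(N)| \le 4^{4^{2s^2}}$ and every element of $N$ is a loop or a coloop of $N$.
   Context: $sU_{1,2}$ denotes the direct sum of $s$ copies of $U_{1,2}$. *)

theory Defs
  imports Main
begin

record 'a pre_matroid =
  ground :: "'a set"
  indeps :: "'a set set"

locale matroid =
  fixes M :: "'a pre_matroid"
  assumes finite_ground: "finite (ground M)"
    and indep_subset_ground: "I \<in> indeps M \<Longrightarrow> I \<subseteq> ground M"
    and indep_empty: "{} \<in> indeps M"
    and indep_subset: "I \<in> indeps M \<Longrightarrow> J \<subseteq> I \<Longrightarrow> J \<in> indeps M"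
    and indep_augment: "I \<in> indeps M \<Longrightarrow> J \<in> indeps M \<Longrightarrow> card I < card J \<Longrightarrow>
      \<exists>x\<in>J - I. insert x I \<in> indeps M"

definition basis_of :: "'a pre_matroid \<Rightarrow> 'a set \<Rightarrow> 'a set \<Rightarrow> bool" where
  "basis_of M X B \<longleftrightarrow> B \<in> indeps M \<and> B \<subseteq> X \<and>
     (\<forall>B'\<in>indeps M. B \<subseteq> B' \<and> B' \<subseteq> X \<longrightarrow> B' = B)"

abbreviation basis :: "'a pre_matroid \<Rightarrow> 'a set \<Rightarrow> bool" where
  "basis M B \<equiv> basis_of M (ground M) B"

definition loop :: "'a pre_matroid \<Rightarrow> 'a \<Rightarrow> bool" where
  "loop M e \<longleftrightarrow> e \<in> ground M \<and> {e} \<notin> indeps M"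

definition coloop :: "'a pre_matroid \<Rightarrow> 'a \<Rightarrow> bool" where
  "coloop M e \<longleftrightarrow> e \<in> ground M \<and> (\<forall>B. basis M B \<longrightarrow> e \<in> B)"

definition delete :: "'a pre_matroid \<Rightarrow> 'a set \<Rightarrow> 'a pre_matroid" where
  "delete M D = \<lparr>ground = ground M - D, indeps = {I \<in> indeps M. I \<subseteq> ground M - D}\<rparr>"

(* In a matroid the choice of the basis B of C is immaterial. *)
definition contract :: "'a pre_matroid \<Rightarrow> 'a set \<Rightarrow> 'a pre_matroid" where
  "contract M C = \<lparr>ground = ground M - C,
     indeps = {I. I \<subseteq> ground M - C \<and> (\<exists>B. basis_of M C B \<and> I \<union> B \<in> indeps M)}\<rparr>"

definition is_minor :: "'a pre_matroid \<Rightarrow> 'a pre_matroid \<Rightarrow> bool" where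
  "is_minor N M \<longleftrightarrow> (\<exists>C D. C \<subseteq> ground M \<and> D \<subseteq> ground M \<and> C \<inter> D = {} \<and>
     N = delete (contract M C) D)"

definition isomorphic :: "'a pre_matroid \<Rightarrow> 'b pre_matroid \<Rightarrow> bool" where
  "isomorphic M N \<longleftrightarrow> (\<exists>f. bij_betw f (ground M) (ground N) \<and>
     (\<forall>X\<subseteq>ground M. X \<in> indeps M \<longleftrightarrow> f ` X \<in> indeps N))"

definition has_minor :: "'a pre_matroid \<Rightarrow> 'b pre_matroid \<Rightarrow> bool" where
  "has_minor M K \<longleftrightarrow> (\<exists>N. is_minor N M \<and> isomorphic N K)"

definition uniform :: "nat \<Rightarrow> nat \<Rightarrow> nat pre_matroid" where
  "uniform r n = \<lparr>ground = {..<n}, indeps = {I. I \<subseteq> {..<n} \<and> card I \<le> r}\<rparr>"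

(* The ground sets of the summands are made disjoint by tagging with the index. *)
definition direct_sum :: "'i set \<Rightarrow> ('i \<Rightarrow> 'a pre_matroid) \<Rightarrow> ('i \<times> 'a) pre_matroid" where
  "direct_sum A M = \<lparr>ground = (SIGMA i:A. ground (M i)),
     indeps = {X. X \<subseteq> (SIGMA i:A. ground (M i)) \<and> (\<forall>i\<in>A. X `` {i} \<in> indeps (M i))}\<rparr>"

definition copies :: "nat \<Rightarrow> 'a pre_matroid \<Rightarrow> (nat \<times> 'a) pre_matroid" where
  "copies s M = direct_sum {..<s} (\<lambda>_. M)"

context matroid
begin

lemma finite_indep: "I \<in> indeps M \<Longrightarrow> finite I"
  using finite_ground indep_subset_ground finite_subset by blast

lemma basis_of_card_le:
  assumes "basis_of M X B" "I \<in> indeps M" "I \<subseteq> X"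
  shows "card I \<le> card B"
proof (rule ccontr)
  assume "\<not> card I \<le> card B"
  then obtain x where "x \<in> I - B" "insert x B \<in> indeps M"
    using indep_augment[of B I] assms by (auto simp: basis_of_def)
  then show False using assms by (auto simp: basis_of_def)
qed

lemma basis_of_card_eq: "basis_of M X B \<Longrightarrow> basis_of M X B' \<Longrightarrow> card B = card B'"
  by (meson basis_of_card_le basis_of_def le_antisym)

lemma basis_of_exists: "\<exists>B. basis_of M X B"
proof -
  let ?S = "{B \<in> indeps M. B \<subseteq> X}"
  have "?S \<subseteq> Pow (ground M)" using indep_subset_ground by auto
  then have "finite ?S" using finite_ground by (meson finite_Pow_iff finite_subset)
  moreover have "?S \<noteq> {}" using indep_empty by auto
  ultimately obtain B where "B \<in> ?S" "\<forall>B'\<in>?S. B \<subseteq> B' \<longrightarrow> B = B'"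
    using finite_has_maximal[of ?S] by blast
  then show ?thesis by (auto simp: basis_of_def)
qed

lemma matroid_delete: "matroid (delete M D)"
proof
  fix I J assume "I \<in> indeps (delete M D)" "J \<in> indeps (delete M D)" "card I < card J"
  then show "\<exists>x\<in>J - I. insert x I \<in> indeps (delete M D)"
    using indep_augment[of I J] by (auto simp: delete_def)
qed (use finite_ground indep_empty indep_subset in \<open>auto simp: delete_def\<close>)

lemma matroid_contract: "matroid (contract M C)"
proof
  show "{} \<in> indeps (contract M C)"
    using basis_of_exists[of C] by (auto simp: contract_def basis_of_def)
next
  fix I J assume I: "I \<in> indeps (contract M C)" and "J \<subseteq> I"
  then obtain B where B: "basis_of M C B" "I \<union> B \<in> indeps M"
    by (auto simp: contract_def)
  have "J \<union> B \<in> indeps M"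
    using B(2) by (rule indep_subset) (use \<open>J \<subseteq> I\<close> in auto)
  then show "J \<in> indeps (contract M C)"
    using I B(1) \<open>J \<subseteq> I\<close> by (auto simp: contract_def)
next
  fix I J assume I: "I \<in> indeps (contract M C)" and J: "J \<in> indeps (contract M C)"
    and less: "card I < card J"
  obtain B where B: "basis_of M C B" "I \<union> B \<in> indeps M" "I \<subseteq> ground M - C"
    using I by (auto simp: contract_def)
  obtain B' where B': "basis_of M C B'" "J \<union> B' \<in> indeps M" "J \<subseteq> ground M - C"
    using J by (auto simp: contract_def)
  have sub: "B \<subseteq> C" "B' \<subseteq> C" using B(1) B'(1) by (auto simp: basis_of_def)
  have "finite (I \<union> B)" "finite (J \<union> B')" using finite_indep B(2) B'(2) by blast+
  moreover have "I \<inter> B = {}" "J \<inter> B' = {}" using B(3) B'(3) sub by auto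
  ultimately have "card (I \<union> B) < card (J \<union> B')"
    using less basis_of_card_eq[OF B(1) B'(1)] by (simp add: card_Un_disjoint)
  then obtain x where x: "x \<in> (J \<union> B') - (I \<union> B)" "insert x (I \<union> B) \<in> indeps M"
    using indep_augment[OF B(2) B'(2)] by blast
  have "x \<notin> C"
  proof
    assume "x \<in> C"
    moreover have "insert x B \<in> indeps M" by (rule indep_subset[OF x(2)]) auto
    ultimately have "insert x B = B" using B(1) by (auto simp: basis_of_def)
    then show False using x(1) by auto
  qed
  then have "x \<in> J - I" "insert x I \<in> indeps (contract M C)"
    using x sub B B'(3) by (auto simp: contract_def)
  then show "\<exists>x\<in>J - I. insert x I \<in> indeps (contract M C)" by blast
qed (use finite_ground in \<open>auto simp: contract_def\<close>)

end

lemma matroid_minor: "matroid M \<Longrightarrow> is_minor N M \<Longrightarrow> matroid N"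
  unfolding is_minor_def using matroid.matroid_delete matroid.matroid_contract by blast

lemma matroid_uniform: "matroid (uniform r n)"
proof
  fix I J assume I: "I \<in> indeps (uniform r n)" and J: "J \<in> indeps (uniform r n)"
    and less: "card I < card J"
  have fin: "finite I" "finite J" using I J by (auto simp: uniform_def intro: finite_subset)
  then obtain x where "x \<in> J - I"
    using less by (metis Diff_eq_empty_iff card_mono ex_in_conv leD)
  then show "\<exists>x\<in>J - I. insert x I \<in> indeps (uniform r n)"
    using I J less fin by (intro bexI[of _ x]) (auto simp: uniform_def)
next
  fix I J assume "I \<in> indeps (uniform r n)" "J \<subseteq> I"
  then show "J \<in> indeps (uniform r n)"
    by (auto simp: uniform_def) (meson card_mono finite_lessThan finite_subset le_trans)
qed (auto simp: uniform_def)

lemma matroid_direct_sum: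
  assumes fin: "finite A" and M: "\<And>i. i \<in> A \<Longrightarrow> matroid (M i)"
  shows "matroid (direct_sum A M)"
proof
  show "finite (ground (direct_sum A M))"
    using fin M by (auto simp: direct_sum_def intro: matroid.finite_ground)
  show "{} \<in> indeps (direct_sum A M)"
    using M by (auto simp: direct_sum_def intro: matroid.indep_empty)
next
  fix I assume "I \<in> indeps (direct_sum A M)"
  then show "I \<subseteq> ground (direct_sum A M)" by (auto simp: direct_sum_def)
next
  fix I J assume I: "I \<in> indeps (direct_sum A M)" and "J \<subseteq> I"
  have "J `` {i} \<in> indeps (M i)" if i: "i \<in> A" for i
  proof (rule matroid.indep_subset[OF M[OF i]])
    show "I `` {i} \<in> indeps (M i)" using I i by (simp add: direct_sum_def)
    show "J `` {i} \<subseteq> I `` {i}" using \<open>J \<subseteq> I\<close> by blast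
  qed
  then show "J \<in> indeps (direct_sum A M)"
    using I \<open>J \<subseteq> I\<close> by (simp add: direct_sum_def) (meson subset_trans)
next
  fix I J assume I: "I \<in> indeps (direct_sum A M)" and J: "J \<in> indeps (direct_sum A M)"
    and less: "card I < card J"
  have card_eq: "card X = (\<Sum>i\<in>A. card (X `` {i}))" if X: "X \<in> indeps (direct_sum A M)" for X
  proof -
    have eq: "(SIGMA i:A. X `` {i}) = X" using X by (auto simp: direct_sum_def)
    have "\<forall>i\<in>A. finite (X `` {i})"
    proof
      fix i assume i: "i \<in> A"
      then have "X `` {i} \<in> indeps (M i)" using X by (simp add: direct_sum_def)
      then show "finite (X `` {i})" by (rule matroid.finite_indep[OF M[OF i]])
    qed
    then have "card (SIGMA i:A. X `` {i}) = (\<Sum>i\<in>A. card (X `` {i}))"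
      using fin by (intro card_SigmaI) auto
    then show ?thesis unfolding eq .
  qed
  have "\<exists>i\<in>A. card (I `` {i}) < card (J `` {i})"
  proof (rule ccontr)
    assume "\<not> ?thesis"
    then have "(\<Sum>i\<in>A. card (J `` {i})) \<le> (\<Sum>i\<in>A. card (I `` {i}))"
      by (intro sum_mono) (simp add: not_less)
    then show False using less card_eq[OF I] card_eq[OF J] by linarith
  qed
  then obtain i where i: "i \<in> A" "card (I `` {i}) < card (J `` {i})" by blast
  interpret Mi: matroid "M i" using M i by blast
  have "I `` {i} \<in> indeps (M i)" "J `` {i} \<in> indeps (M i)"
    using I J i(1) by (simp_all add: direct_sum_def)
  then obtain x where x: "x \<in> J `` {i} - I `` {i}" "insert x (I `` {i}) \<in> indeps (M i)"
    using Mi.indep_augment i(2) by blast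
  have "insert (i, x) I `` {j} = (if j = i then insert x (I `` {i}) else I `` {j})" for j
    by auto
  moreover have "insert (i, x) I \<subseteq> (SIGMA i:A. ground (M i))"
    using I J x(1) by (auto simp: direct_sum_def)
  ultimately have "insert (i, x) I \<in> indeps (direct_sum A M)"
    using I x(2) by (simp add: direct_sum_def)
  then show "\<exists>x\<in>J - I. insert x I \<in> indeps (direct_sum A M)" using x by blast
qed

end

(*
  Let B be a basis and F a basis of its complement. Contracting F and deleting |F| suitable
  elements of B leaves only loops and coloops, so F may be assumed to be large, and M to have no
  U_{s,2s}-minor. Then a large family of elements of rank at most s over a set K contains a large
  subfamily in the span over K of fewer than s of its members: otherwise 2s members chosen greedily
  are in general position over K.

  Applied repeatedly inside smaller and smaller flats, this yields a contraction of M with elements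
  b_1, ..., b_t and f_1, ..., f_t whose fundamental incidences are lower triangular: f_i is spanned
  by b_1, ..., b_i and has b_i in its support. Applied a second time, to such a triangular
  configuration, it splits off a single parallel pair b_i, f_i, skew to a triangular configuration
  that is still large. Repeating this s times gives s skew parallel pairs, an sU_{1,2}-minor.
*)

theory Submission
  imports Defs
begin

text \<open>In a triangular configuration, contracting all \<open>b_j\<close> with
  \<open>j \<noteq> i\<close> already makes \<open>f_i\<close> parallel to \<open>b_i\<close>. The
  difficulty is to achieve this for \<open>s\<close> indices at once, since no \<open>b_i\<close> of
  a surviving pair may be contracted; hence the second pass, which frees one pair at a time. The
  triangular order comes from the flats: each of them misses some element of \<open>F\<close>, which
  becomes the next \<open>f_i\<close>, while everything chosen before lies inside the flat. The
  factor \<open>4^s\<close> bounds the number of subsets of fewer than \<open>2s\<close> greedily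
  chosen members. Each step of either pass costs about this factor: splitting off \<open>s\<close>
  pairs takes length \<open>t = (4^s + s)^s\<close>, and a configuration of length \<open>t\<close>
  takes \<open>4^(s t)\<close> elements of \<open>F\<close>. The two passes compose to the double
  exponential.\<close>

context matroid
begin

section \<open>Rank and closure\<close>

definition rk :: "'a set \<Rightarrow> nat" where
  "rk X = card (SOME B. basis_of M X B)"

text \<open>Elements outside the ground set behave like loops: they lie in every closure.\<close>

definition cl :: "'a set \<Rightarrow> 'a set" where
  "cl X = {e. rk (insert e X) = rk X}"

lemma rk_basis: "basis_of M X B \<Longrightarrow> rk X = card B"
  unfolding rk_def by (metis basis_of_card_eq basis_of_exists someI_ex)

lemma card_indep_le_rk: "I \<in> indeps M \<Longrightarrow> I \<subseteq> X \<Longrightarrow> card I \<le> rk X"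
  by (metis basis_of_card_le basis_of_exists rk_basis)

lemma rk_indep: "I \<in> indeps M \<Longrightarrow> rk I = card I"
  by (rule rk_basis) (auto simp: basis_of_def)

lemma extend_to_basis:
  assumes "I \<in> indeps M" "I \<subseteq> X"
  obtains B where "basis_of M X B" "I \<subseteq> B"
proof -
  let ?S = "{B \<in> indeps M. I \<subseteq> B \<and> B \<subseteq> X}"
  have "?S \<subseteq> Pow (ground M)" using indep_subset_ground by auto
  then have "finite ?S" using finite_ground by (meson finite_Pow_iff finite_subset)
  moreover have "?S \<noteq> {}" using assms by auto
  ultimately obtain B where "B \<in> ?S" "\<forall>B'\<in>?S. B \<subseteq> B' \<longrightarrow> B = B'"
    using finite_has_maximal[of ?S] by blast
  then have "basis_of M X B" "I \<subseteq> B" by (auto simp: basis_of_def)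
  then show ?thesis by (rule that)
qed

lemma rk_mono: "X \<subseteq> Y \<Longrightarrow> rk X \<le> rk Y"
  by (metis basis_of_def basis_of_exists card_indep_le_rk rk_basis subset_trans)

text \<open>The bridge between \<open>cl\<close>, defined through rank, and independence;
  monotonicity and idempotence of \<open>cl\<close> are read off from it. If the rank grows,
  augmenting \<open>B\<close> from a basis of \<open>insert e X\<close> can only add
  \<open>e\<close>, because \<open>B\<close> is maximal in \<open>X\<close>.\<close>

lemma notin_cl_iff:
  assumes B: "basis_of M X B"
  shows "e \<notin> cl X \<longleftrightarrow> e \<notin> B \<and> insert e B \<in> indeps M"
proof
  assume e: "e \<notin> cl X"
  have "rk X \<le> rk (insert e X)" by (rule rk_mono) auto
  with e have less: "card B < rk (insert e X)" using rk_basis[OF B] by (auto simp: cl_def)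
  obtain B' where B': "basis_of M (insert e X) B'" using basis_of_exists by blast
  then obtain x where x: "x \<in> B' - B" "insert x B \<in> indeps M"
    using less indep_augment[of B B'] B rk_basis[OF B'] by (auto simp: basis_of_def)
  have "x \<notin> X" using B x by (auto simp: basis_of_def)
  then have "x = e" using x B' by (auto simp: basis_of_def)
  then show "e \<notin> B \<and> insert e B \<in> indeps M" using x by auto
next
  assume e: "e \<notin> B \<and> insert e B \<in> indeps M"
  then have "card (insert e B) \<le> rk (insert e X)"
    using B by (intro card_indep_le_rk) (auto simp: basis_of_def)
  moreover have "finite B" using B finite_indep by (auto simp: basis_of_def)
  ultimately show "e \<notin> cl X" using e rk_basis[OF B] by (auto simp: cl_def)
qed

lemma subset_cl: "X \<subseteq> cl X"
  by (auto simp: cl_def insert_absorb)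

lemma cl_mono:
  assumes XY: "X \<subseteq> Y"
  shows "cl X \<subseteq> cl Y"
proof (rule ccontr)
  assume "\<not> cl X \<subseteq> cl Y"
  then obtain e where e: "e \<in> cl X" "e \<notin> cl Y" by auto
  obtain B where B: "basis_of M X B" using basis_of_exists by blast
  then have "B \<in> indeps M" "B \<subseteq> Y" using XY by (auto simp: basis_of_def)
  then obtain B' where B': "basis_of M Y B'" "B \<subseteq> B'" by (rule extend_to_basis)
  have "e \<notin> B'" "insert e B' \<in> indeps M" using e(2) notin_cl_iff[OF B'(1)] by auto
  then have "e \<notin> B" "insert e B \<in> indeps M"
    using B'(2) indep_subset[of "insert e B'" "insert e B"] by auto
  then show False using e(1) notin_cl_iff[OF B, of e] by simp
qed

lemma cl_monoD: "e \<in> cl X \<Longrightarrow> X \<subseteq> Y \<Longrightarrow> e \<in> cl Y"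
  using cl_mono by blast

lemma basis_of_spanned:
  assumes "basis_of M X B" "X \<subseteq> Y" "Y \<subseteq> cl X"
  shows "basis_of M Y B"
  unfolding basis_of_def
proof (intro conjI ballI impI)
  fix B' assume B': "B' \<in> indeps M" "B \<subseteq> B' \<and> B' \<subseteq> Y"
  show "B' = B"
  proof (rule ccontr)
    assume "B' \<noteq> B"
    then obtain e where e: "e \<in> B'" "e \<notin> B" using B' by auto
    then have "insert e B \<in> indeps M" using B' by (meson indep_subset insert_subset)
    then have "e \<notin> cl X" using e notin_cl_iff[OF assms(1)] by auto
    then show False using e B' assms by auto
  qed
qed (use assms in \<open>auto simp: basis_of_def\<close>)

lemma rk_Un_spanned: "Y \<subseteq> cl X \<Longrightarrow> rk (X \<union> Y) = rk X"
  using basis_of_exists[of X] basis_of_spanned[of X _ "X \<union> Y"] rk_basis subset_cl[of X]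
  by (metis Un_least Un_upper1)

lemma rk_cl: "rk (cl X) = rk X"
  using rk_Un_spanned[of "cl X" X] subset_cl[of X] by (simp add: Un_absorb1)

lemma cl_cl: "cl (cl X) = cl X"
proof
  obtain B where B: "basis_of M X B" using basis_of_exists by blast
  then have "basis_of M (cl X) B" using basis_of_spanned subset_cl by blast
  then show "cl (cl X) \<subseteq> cl X" using notin_cl_iff[OF B] notin_cl_iff[of "cl X" B] by auto
qed (rule subset_cl)

lemma cl_subset: "X \<subseteq> cl Y \<Longrightarrow> cl X \<subseteq> cl Y"
  using cl_mono cl_cl by metis

lemma cl_trans: "e \<in> cl X \<Longrightarrow> X \<subseteq> cl Y \<Longrightarrow> e \<in> cl Y"
  using cl_subset by blast

lemma rk_le_spanned: "X \<subseteq> cl Y \<Longrightarrow> rk X \<le> rk Y"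
  using rk_mono rk_cl by metis

lemma rk_insert_notin: "e \<notin> cl X \<Longrightarrow> rk (insert e X) = Suc (rk X)"
proof -
  assume e: "e \<notin> cl X"
  obtain B where B: "basis_of M X B" using basis_of_exists by blast
  have *: "insert e B \<in> indeps M" "e \<notin> B" using e notin_cl_iff[OF B] by auto
  have "insert e X \<subseteq> cl (insert e B)"
  proof -
    have "X \<subseteq> cl B"
    proof
      fix x assume "x \<in> X"
      have BB: "basis_of M B B" using B by (auto simp: basis_of_def)
      show "x \<in> cl B"
        using \<open>x \<in> X\<close> notin_cl_iff[OF BB, of x] B by (auto simp: basis_of_def)
    qed
    then show ?thesis using cl_mono[of B "insert e B"] subset_cl[of "insert e B"] by auto
  qed
  then have "rk (insert e X) \<le> rk (insert e B)" by (rule rk_le_spanned)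
  moreover have "rk (insert e B) \<le> rk (insert e X)"
    using B by (intro rk_mono) (auto simp: basis_of_def)
  moreover have "finite B" using B finite_indep by (auto simp: basis_of_def)
  ultimately show ?thesis using * rk_indep rk_basis[OF B] by simp
qed

lemma rk_insert_le: "rk (insert e X) \<le> Suc (rk X)"
  using rk_insert_notin[of e X] by (cases "e \<in> cl X") (auto simp: cl_def)

lemma rk_Un_le: "finite Y \<Longrightarrow> rk (X \<union> Y) \<le> rk X + card Y"
proof (induction Y rule: finite_induct)
  case (insert y Y)
  then show ?case using rk_insert_le[of y "X \<union> Y"] by simp
qed simp

lemma rk_Un_image_le: "finite I \<Longrightarrow> rk (X \<union> b ` I) \<le> rk X + card I"
  using rk_Un_le[of "b ` I" X] card_image_le[of I b] by simp

lemma exchange: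
  assumes "e \<in> cl (insert x X)" "e \<notin> cl X"
  shows "x \<in> cl (insert e X)"
proof -
  have "rk (insert x (insert e X)) = rk (insert x X)"
    using assms(1) by (simp add: cl_def insert_commute)
  moreover have "rk (insert e X) = Suc (rk X)" using assms(2) by (rule rk_insert_notin)
  moreover have "rk (insert e X) \<le> rk (insert x (insert e X))" by (rule rk_mono) auto
  ultimately show ?thesis using rk_insert_le[of x X] by (simp add: cl_def)
qed

text \<open>An element of \<open>cl Y\<close> outside \<open>cl X\<close> would raise the rank of
  \<open>X\<close> above that of \<open>Y\<close>. This turns rank counts into spanning
  statements.\<close>

lemma subset_cl_of_rk_le:
  assumes "X \<subseteq> cl Y" "rk Y \<le> rk X"
  shows "cl Y \<subseteq> cl X"
proof
  fix e assume "e \<in> cl Y"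
  show "e \<in> cl X"
  proof (rule ccontr)
    assume "e \<notin> cl X"
    then have "rk (insert e X) = Suc (rk X)" by (rule rk_insert_notin)
    moreover have "rk (insert e X) \<le> rk Y"
      using assms \<open>e \<in> cl Y\<close> by (intro rk_le_spanned) auto
    ultimately show False using assms by simp
  qed
qed

lemma rk_Un_image_indep:
  "finite I \<Longrightarrow> \<forall>i\<in>I. b i \<notin> cl (K \<union> b ` (I - {i})) \<Longrightarrow> rk (K \<union> b ` I) = rk K + card I"
proof (induction I rule: finite_induct)
  case (insert x I)
  have "\<forall>i\<in>I. b i \<notin> cl (K \<union> b ` (I - {i}))"
  proof
    fix i assume "i \<in> I"
    then have "b i \<notin> cl (K \<union> b ` (insert x I - {i}))" using insert by auto
    then show "b i \<notin> cl (K \<union> b ` (I - {i}))" by (rule contrapos_nn) (erule cl_monoD, auto)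
  qed
  then have "rk (K \<union> b ` I) = rk K + card I" using insert by auto
  moreover have "b x \<notin> cl (K \<union> b ` I)" using insert by simp
  ultimately show ?case using rk_insert_notin[of "b x" "K \<union> b ` I"] insert by simp
qed simp

lemma notin_cl_of_rk_Un:
  assumes "finite X" "rk (K \<union> X) = rk K + card X" "x \<in> X"
  shows "x \<notin> cl (K \<union> (X - {x}))"
proof
  assume "x \<in> cl (K \<union> (X - {x}))"
  then have "rk (insert x (K \<union> (X - {x}))) = rk (K \<union> (X - {x}))" by (simp add: cl_def)
  moreover have "insert x (K \<union> (X - {x})) = K \<union> X" using assms by auto
  ultimately show False
    using assms rk_Un_le[of "X - {x}" K] card_gt_0_iff[of X] by (auto simp: card_Diff_singleton)
qed

lemma indep_iff_rk: "finite X \<Longrightarrow> X \<in> indeps M \<longleftrightarrow> rk X = card X"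
proof
  assume "finite X" "rk X = card X"
  moreover obtain B where "basis_of M X B" using basis_of_exists by blast
  ultimately show "X \<in> indeps M" using rk_basis[of X B] by (metis basis_of_def card_subset_eq)
qed (rule rk_indep)

lemma rk_empty [simp]: "rk {} = 0"
  using rk_indep[OF indep_empty] by simp

text \<open>If \<open>Y\<close> is independent over \<open>V\<close>, contracting \<open>Y\<close> does not affect closures inside \<open>V\<close>.\<close>

lemma cl_skew:
  "finite Y \<Longrightarrow> rk (V \<union> Y) = rk V + card Y \<Longrightarrow> A \<subseteq> cl V \<Longrightarrow> e \<in> cl V \<Longrightarrow>
    e \<in> cl (A \<union> Y) \<Longrightarrow> e \<in> cl A"
proof (induction Y rule: finite_induct)
  case (insert y Y)
  have y: "y \<notin> cl (V \<union> Y)"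
    using notin_cl_of_rk_Un[of "insert y Y" V y] insert by auto
  have "rk (V \<union> Y) = rk V + card Y"
    using rk_insert_notin[OF y] insert by simp
  moreover have "e \<in> cl (A \<union> Y)"
  proof (rule ccontr)
    assume "e \<notin> cl (A \<union> Y)"
    then have "y \<in> cl (insert e (A \<union> Y))" using exchange insert.prems by simp
    moreover have "insert e (A \<union> Y) \<subseteq> cl (V \<union> Y)"
      using insert.prems cl_mono[of V "V \<union> Y"] subset_cl[of "V \<union> Y"] by auto
    ultimately show False using y cl_trans by blast
  qed
  ultimately show ?case using insert by blast
qed simp

section \<open>Contractions and minors in terms of rank\<close>

lemma notin_cl_in_ground: "e \<notin> cl X \<Longrightarrow> e \<in> ground M"
  using basis_of_exists[of X] notin_cl_iff[of X _ e] indep_subset_ground by blast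

lemma rk_Int_ground: "rk (X \<inter> ground M) = rk X"
proof -
  have "X \<subseteq> cl (X \<inter> ground M)"
  proof
    fix e assume "e \<in> X"
    show "e \<in> cl (X \<inter> ground M)"
      using \<open>e \<in> X\<close> notin_cl_in_ground[of e] subset_cl[of "X \<inter> ground M"] by auto
  qed
  then show ?thesis using rk_le_spanned rk_mono[of "X \<inter> ground M" X] by (simp add: le_antisym)
qed

lemma contract_indep_iff:
  assumes "X \<subseteq> ground M - K"
  shows "X \<in> indeps (contract M K) \<longleftrightarrow> rk (K \<union> X) = rk K + card X"
proof
  have finX: "finite X" using assms finite_ground by (meson finite_Diff finite_subset)
  assume "X \<in> indeps (contract M K)"
  then obtain B where B: "basis_of M K B" "X \<union> B \<in> indeps M"
    by (auto simp: contract_def)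
  have "card (X \<union> B) \<le> rk (K \<union> X)"
    using B by (intro card_indep_le_rk) (auto simp: basis_of_def)
  moreover have "X \<inter> B = {}" using B assms by (auto simp: basis_of_def)
  ultimately have "rk K + card X \<le> rk (K \<union> X)"
    using rk_basis[OF B(1)] finX finite_indep[OF B(2)] by (simp add: card_Un_disjoint)
  then show "rk (K \<union> X) = rk K + card X" using rk_Un_le[OF finX, of K] by simp
next
  assume eq: "rk (K \<union> X) = rk K + card X"
  have finX: "finite X" using assms finite_ground by (meson finite_Diff finite_subset)
  obtain B where B: "basis_of M K B" using basis_of_exists by blast
  then obtain B' where B': "basis_of M (K \<union> X) B'" "B \<subseteq> B'"
    using extend_to_basis[of B "K \<union> X"] by (auto simp: basis_of_def)
  have finB: "finite B" "finite B'" using B B' finite_indep by (auto simp: basis_of_def)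
  have "B' \<inter> K \<in> indeps M" using B' indep_subset by (auto simp: basis_of_def)
  then have "B' \<inter> K = B" using B B' by (auto simp: basis_of_def)
  then have sub: "B' \<subseteq> B \<union> X" using B' by (auto simp: basis_of_def)
  have "card (B \<union> X) \<le> card B'"
    using card_Un_le[of B X] eq rk_basis[OF B] rk_basis[OF B'(1)] by simp
  then have "B' = B \<union> X" using sub finB finX by (intro card_seteq) auto
  then show "X \<in> indeps (contract M K)"
    using B B' assms by (auto simp: contract_def basis_of_def Un_commute)
qed

text \<open>The minor contracts \<open>K\<close> and deletes what is neither in \<open>K\<close> nor
  in \<open>P\<close>. Elements of \<open>K\<close> outside the ground set do not change any rank,
  so contracting \<open>K \<inter> ground M\<close> yields the rank condition for \<open>K\<close>
  itself.\<close>

lemma minor_exists: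
  assumes "P \<subseteq> ground M - K"
  shows "\<exists>N. is_minor N M \<and> ground N = P \<and>
    (\<forall>X\<subseteq>P. X \<in> indeps N \<longleftrightarrow> rk (K \<union> X) = rk K + card X)"
proof -
  let ?K = "K \<inter> ground M" and ?D = "ground M - K - P"
  let ?N = "delete (contract M ?K) ?D"
  have "is_minor ?N M" unfolding is_minor_def by (intro exI[of _ ?K] exI[of _ ?D]) auto
  moreover have "ground ?N = P" using assms by (auto simp: delete_def contract_def)
  moreover have "X \<in> indeps ?N \<longleftrightarrow> rk (K \<union> X) = rk K + card X" if X: "X \<subseteq> P" for X
  proof -
    have "X \<in> indeps ?N \<longleftrightarrow> X \<in> indeps (contract M ?K)"
      using X assms by (auto simp: delete_def contract_def)
    also have "\<dots> \<longleftrightarrow> rk (?K \<union> X) = rk ?K + card X"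
      using X assms by (intro contract_indep_iff) auto
    also have "rk (?K \<union> X) = rk (K \<union> X)"
    proof -
      have "(K \<union> X) \<inter> ground M = ?K \<union> X" using X assms by auto
      then show ?thesis using rk_Int_ground[of "K \<union> X"] by simp
    qed
    finally show ?thesis by (simp add: rk_Int_ground)
  qed
  ultimately show ?thesis by (intro exI[of _ ?N]) simp
qed

section \<open>Uniform minors and dense flats\<close>

lemma has_minor_uniformI:
  assumes P: "finite P" "card P = 2 * s" and inj: "inj_on f P"
    and free: "\<And>Z. Z \<subseteq> P \<Longrightarrow> card Z = s \<Longrightarrow> rk (K \<union> f ` Z) = rk K + s"
    and le: "rk (K \<union> f ` P) \<le> rk K + s"
  shows "has_minor M (uniform s (2 * s))"
proof -
  have small: "rk (K \<union> f ` Z) = rk K + card Z" if Z: "Z \<subseteq> P" "card Z \<le> s" for Z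
  proof -
    have "finite Z" using P Z finite_subset by blast
    obtain Z' where Z': "Z \<subseteq> Z'" "Z' \<subseteq> P" "card Z' = s"
      using exists_subset_between[of Z s P] Z P by auto
    have finZ': "finite Z'" using Z' P finite_subset by blast
    have "rk K + s = rk ((K \<union> f ` Z) \<union> f ` (Z' - Z))"
      using free[of Z'] Z' by (simp add: Un_assoc image_Un[symmetric] Un_absorb1)
    also have "\<dots> \<le> rk (K \<union> f ` Z) + card (Z' - Z)" using finZ' by (intro rk_Un_image_le) auto
    also have "card (Z' - Z) = s - card Z" using Z' \<open>finite Z\<close> by (simp add: card_Diff_subset)
    finally show ?thesis using rk_Un_image_le[of Z K f] \<open>finite Z\<close> Z by simp
  qed
  have notin: "f x \<notin> cl K" if "x \<in> P" for x
  proof -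
    have "card {x} \<le> s" using that P by (cases s) auto
    then show ?thesis using small[of "{x}"] that by (auto simp: cl_def)
  qed
  have sub: "f ` P \<subseteq> ground M - K"
    using notin notin_cl_in_ground subset_cl[of K] by blast
  obtain N where N: "is_minor N M" "ground N = f ` P"
    "\<forall>X\<subseteq>f ` P. X \<in> indeps N \<longleftrightarrow> rk (K \<union> X) = rk K + card X"
    using minor_exists[OF sub] by (elim exE conjE)
  have indep: "X \<in> indeps N \<longleftrightarrow> card X \<le> s" if X: "X \<subseteq> f ` P" for X
  proof -
    obtain Z where Z: "Z \<subseteq> P" "X = f ` Z" using X by (meson subset_imageE)
    have "card X = card Z" using Z inj by (metis card_image inj_on_subset)
    moreover have "rk (K \<union> f ` Z) \<le> rk K + s"
      using le rk_mono[of "K \<union> f ` Z" "K \<union> f ` P"] Z by fastforce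
    ultimately show ?thesis using N(3) X small[of Z] Z by auto
  qed
  have "card (f ` P) = 2 * s" using inj P by (simp add: card_image)
  then obtain g where g: "bij_betw g (f ` P) {..<2 * s}"
    using P ex_bij_betw_finite_nat[of "f ` P"] by (auto simp: atLeast0LessThan)
  have "X \<in> indeps N \<longleftrightarrow> g ` X \<in> indeps (uniform s (2 * s))" if X: "X \<subseteq> f ` P" for X
  proof -
    have "card (g ` X) = card X" using g X by (metis bij_betw_def card_image inj_on_subset)
    moreover have "g ` X \<subseteq> {..<2 * s}" using g X by (auto simp: bij_betw_def)
    ultimately show ?thesis using indep[OF X] by (simp add: uniform_def)
  qed
  then have "isomorphic N (uniform s (2 * s))"
    using g N(2) by (auto simp: isomorphic_def uniform_def intro!: exI[of _ g])
  then show ?thesis using N(1) by (auto simp: has_minor_def)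
qed

text \<open>The equivalence mentions \<open>P\<close> on both sides, but for a given
  \<open>j\<close> only members below \<open>j\<close> matter. It is therefore a recursion along the
  order of the indices, solved by adding them in increasing order.\<close>

lemma greedy_set_exists:
  fixes R :: "nat set"
  assumes "finite R"
  obtains P where "P \<subseteq> R"
    "\<And>j. j \<in> R \<Longrightarrow> j \<in> P \<longleftrightarrow> (\<forall>S\<subseteq>P. (\<forall>i\<in>S. i < j) \<and> card S < s \<longrightarrow> f j \<notin> cl (K \<union> f ` S))"
proof -
  have "\<exists>P\<subseteq>R. \<forall>j\<in>R. j \<in> P \<longleftrightarrow>
      (\<forall>S\<subseteq>P. (\<forall>i\<in>S. i < j) \<and> card S < s \<longrightarrow> f j \<notin> cl (K \<union> f ` S))"
    using assms
  proof (induction R rule: finite_linorder_max_induct)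
    case (insert b R)
    then obtain P where P: "P \<subseteq> R" "\<forall>j\<in>R. j \<in> P \<longleftrightarrow>
      (\<forall>S\<subseteq>P. (\<forall>i\<in>S. i < j) \<and> card S < s \<longrightarrow> f j \<notin> cl (K \<union> f ` S))" by blast
    define Q where "Q = (if \<forall>S\<subseteq>P. card S < s \<longrightarrow> f b \<notin> cl (K \<union> f ` S) then insert b P else P)"
    have "b \<notin> R" using insert by blast
    have PQ: "P \<subseteq> Q" "Q \<subseteq> insert b P" by (auto simp: Q_def)
    have eq: "S \<subseteq> Q \<and> (\<forall>i\<in>S. i < j) \<longleftrightarrow> S \<subseteq> P \<and> (\<forall>i\<in>S. i < j)" if "j \<in> insert b R" for S j
      using PQ that insert(2) by fastforce
    have "j \<in> Q \<longleftrightarrow> (\<forall>S\<subseteq>Q. (\<forall>i\<in>S. i < j) \<and> card S < s \<longrightarrow> f j \<notin> cl (K \<union> f ` S))"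
      if j: "j \<in> insert b R" for j
    proof (cases "j = b")
      case True
      have "b \<in> Q \<longleftrightarrow> (\<forall>S\<subseteq>P. card S < s \<longrightarrow> f b \<notin> cl (K \<union> f ` S))"
        using P \<open>b \<notin> R\<close> by (auto simp: Q_def)
      moreover have "\<forall>S\<subseteq>P. \<forall>i\<in>S. i < b" using P insert(2) by blast
      ultimately show ?thesis using eq[OF j] True by metis
    next
      case False
      then have "j \<in> R" "j \<in> Q \<longleftrightarrow> j \<in> P" using j by (auto simp: Q_def)
      then show ?thesis using P eq[OF j] by metis
    qed
    moreover have "Q \<subseteq> insert b R" using PQ P by auto
    ultimately show ?case by (intro exI[of _ Q] conjI ballI) auto
  qed simp
  then show ?thesis using that by metis
qed

text \<open>If the greedy set has fewer than \<open>2 * s\<close> members, it has at most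
  \<open>4 ^ s\<close> subsets, and every rejected index was rejected because of one of them, so one
  subset accounts for many indices. That these indices exceed the members of \<open>S\<close> comes
  from the greedy order; it is what later preserves triangularity.\<close>

lemma uniform_minor_or_dense_flat:
  fixes R :: "nat set"
  assumes R: "finite R" "inj_on f R" "4 ^ s * q \<le> card R" and q: "1 \<le> q"
    and le: "rk (K \<union> f ` R) \<le> rk K + s"
    and no_uniform: "\<not> has_minor M (uniform s (2 * s))"
  shows "\<exists>S\<subseteq>R. card S < s \<and>
    q \<le> card {j \<in> R. (\<forall>i\<in>S. i < j) \<and> f j \<in> cl (K \<union> f ` S)}"
proof (rule ccontr)
  assume "\<not> ?thesis"
  then have less: "card {j \<in> R. (\<forall>i\<in>S. i < j) \<and> f j \<in> cl (K \<union> f ` S)} < q"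
    if "S \<subseteq> R" "card S < s" for S
    using that by (meson not_le)
  obtain P where P: "P \<subseteq> R" "\<And>j. j \<in> R \<Longrightarrow> j \<in> P \<longleftrightarrow>
      (\<forall>S\<subseteq>P. (\<forall>i\<in>S. i < j) \<and> card S < s \<longrightarrow> f j \<notin> cl (K \<union> f ` S))"
    using greedy_set_exists[OF R(1), of s f K] by metis
  have finP: "finite P" using P R finite_subset by blast
  \<comment> \<open>Taken in increasing order, each member has fewer than \<open>s\<close>
    predecessors in \<open>Z\<close>, and the greedy rule keeps it out of their span.\<close>
  have free: "card Z \<le> s \<Longrightarrow> Z \<subseteq> P \<Longrightarrow> rk (K \<union> f ` Z) = rk K + card Z" if "finite Z" for Z
    using that
  proof (induction Z rule: finite_linorder_max_induct)
    case (insert b Z)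
    have "b \<notin> Z" using insert by blast
    then have "card Z < s" using insert by simp
    then have "f b \<notin> cl (K \<union> f ` Z)" using P(2)[of b] P(1) insert by auto
    then show ?case using rk_insert_notin[of "f b" "K \<union> f ` Z"] insert \<open>b \<notin> Z\<close> by simp
  qed simp
  show False
  proof (cases "2 * s \<le> card P")
    case True
    then obtain P' where P': "P' \<subseteq> P" "card P' = 2 * s" by (meson obtain_subset_with_card_n)
    have finP': "finite P'" using P' finP finite_subset by blast
    have "has_minor M (uniform s (2 * s))"
    proof (rule has_minor_uniformI[OF finP' P'(2)])
      show "inj_on f P'" using R P' P by (meson inj_on_subset)
      show "rk (K \<union> f ` Z) = rk K + s" if "Z \<subseteq> P'" "card Z = s" for Z
        using free[of Z] that finP' P' finite_subset[of Z P'] by auto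
      have "rk (K \<union> f ` P') \<le> rk (K \<union> f ` R)" using P' P by (intro rk_mono) auto
      then show "rk (K \<union> f ` P') \<le> rk K + s" using le by simp
    qed
    then show False using no_uniform by simp
  next
    case False
    let ?D = "\<lambda>S. {j \<in> R. (\<forall>i\<in>S. i < j) \<and> f j \<in> cl (K \<union> f ` S)}"
    let ?\<S> = "{S \<in> Pow P. card S < s}"
    have "R \<subseteq> P \<union> (\<Union>S\<in>?\<S>. ?D S)" using P(2) by blast
    then have "card R \<le> card (P \<union> (\<Union>S\<in>?\<S>. ?D S))"
      using R finP by (intro card_mono) auto
    also have "\<dots> \<le> card P + (\<Sum>S\<in>?\<S>. card (?D S))"
      using finP by (intro order_trans[OF card_Un_le] add_left_mono card_UN_le) auto
    also have "(\<Sum>S\<in>?\<S>. card (?D S)) \<le> (\<Sum>S\<in>?\<S>. q - 1)"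
    proof (rule sum_mono)
      fix S assume "S \<in> ?\<S>"
      then have "card (?D S) < q" using P(1) by (intro less) auto
      then show "card (?D S) \<le> q - 1" by simp
    qed
    also have "\<dots> \<le> 4 ^ s * (q - 1)"
    proof -
      have "card ?\<S> \<le> card (Pow P)" using finP by (intro card_mono) auto
      also have "\<dots> = 2 ^ card P" using finP by (simp add: card_Pow)
      also have "\<dots> \<le> 2 ^ (2 * s)" using False by (intro power_increasing) auto
      also have "\<dots> = (4 ^ s :: nat)" by (simp add: power_mult)
      finally show ?thesis by simp
    qed
    finally have "card R \<le> card P + 4 ^ s * (q - 1)" by simp
    \<comment> \<open>The greedy set itself has fewer than \<open>4 ^ s\<close> members, which is
      the gap between \<open>4 ^ s * (q - 1)\<close> and \<open>4 ^ s * q\<close>.\<close>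
    moreover have "2 * s < 2 ^ (2 * s)" by (rule less_exp)
    then have "2 * s < 4 ^ s" by (simp add: power_mult)
    ultimately have "card R < 4 ^ s + 4 ^ s * (q - 1)" using False by linarith
    also have "\<dots> = 4 ^ s * q" using q by (cases q) auto
    finally show False using R by simp
  qed
qed

section \<open>Triangular configurations and their construction\<close>

text \<open>
  Over \<open>K\<close>, the \<open>b i\<close> are independent and each \<open>f i\<close> is spanned by them; its fundamental circuit
  contains \<open>b i\<close> and no \<open>b j\<close> with \<open>j > i\<close>. So the fundamental matrix is lower triangular.
\<close>

definition chain :: "'a set \<Rightarrow> (nat \<Rightarrow> 'a) \<Rightarrow> (nat \<Rightarrow> 'a) \<Rightarrow> nat set \<Rightarrow> bool" where
  "chain K b f I \<longleftrightarrow> (\<forall>i\<in>I. b i \<notin> cl (K \<union> b ` (I - {i})) \<and> f i \<notin> cl (K \<union> b ` (I - {i})) \<and>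
     f i \<in> cl (K \<union> b ` {j \<in> I. j \<le> i}) \<and> b i \<noteq> f i)"

lemma chain_rk: "finite I \<Longrightarrow> chain K b f I \<Longrightarrow> rk (K \<union> b ` I) = rk K + card I"
  by (rule rk_Un_image_indep) (auto simp: chain_def)

text \<open>For \<open>i < j\<close>, the span of \<open>K\<close> and all chain members except
  \<open>b j\<close> contains \<open>f i\<close> but not \<open>f j\<close>.\<close>

lemma inj_on_chain:
  assumes "chain K b f I"
  shows "inj_on f I"
proof -
  have "f i \<noteq> f j" if "i \<in> I" "j \<in> I" "i < j" for i j
  proof -
    have "f i \<in> cl (K \<union> b ` {l \<in> I. l \<le> i})" using assms that(1) by (simp add: chain_def)
    then have "f i \<in> cl (K \<union> b ` (I - {j}))" by (rule cl_monoD) (use that in auto)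
    moreover have "f j \<notin> cl (K \<union> b ` (I - {j}))" using assms that(2) by (simp add: chain_def)
    ultimately show ?thesis by auto
  qed
  then show ?thesis by (intro linorder_inj_onI) auto
qed

text \<open>Extend a basis of \<open>C\<close> to a basis of \<open>B\<close> and truncate it to
  \<open>n\<close> elements.\<close>

lemma intermediate_rk:
  assumes "C \<subseteq> B" "rk C \<le> n" "n \<le> rk B"
  shows "\<exists>B'\<subseteq>B. rk B' = n \<and> C \<subseteq> cl B'"
proof -
  obtain E where E: "basis_of M C E" using basis_of_exists by blast
  then have EC: "E \<in> indeps M" "E \<subseteq> C" by (auto simp: basis_of_def)
  then obtain D where D: "basis_of M B D" "E \<subseteq> D"
    using assms(1) extend_to_basis[of E B] by blast
  then have DB: "D \<in> indeps M" "D \<subseteq> B" by (auto simp: basis_of_def)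
  have "card E \<le> n" "n \<le> card D"
    using assms rk_basis[OF E] rk_basis[OF D(1)] by simp_all
  then obtain B' where B': "E \<subseteq> B'" "B' \<subseteq> D" "card B' = n"
    using exists_subset_between[OF _ _ D(2) finite_indep[OF DB(1)], of n] by blast
  have "rk B' = n" using rk_indep[OF indep_subset[OF DB(1) B'(2)]] B'(3) by simp
  moreover have "cl C \<subseteq> cl E"
  proof (rule subset_cl_of_rk_le)
    show "E \<subseteq> cl C" using EC subset_cl[of C] by auto
    show "rk C \<le> rk E" using rk_basis[OF E] rk_indep[OF EC(1)] by simp
  qed
  then have "C \<subseteq> cl B'" using subset_cl[of C] cl_mono[OF B'(1)] by blast
  ultimately show ?thesis using B' DB by blast
qed

text \<open>Let \<open>Y\<close> be maximal in \<open>B\<close> such that it is independent over the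
  chain and \<open>x\<close> stays unspanned. Then any \<open>y\<close> in \<open>B\<close> outside
  the span completes a dependence with \<open>x\<close>. As \<open>Y\<close> and \<open>y\<close>
  are jointly independent over the old chain, contracting \<open>Y\<close> and appending
  \<open>y\<close> leaves the old incidences intact. The new pair is a pair of distinct elements
  because \<open>x\<close> is not in \<open>B\<close>.\<close>

lemma chain_extend:
  assumes ch: "chain K b g {..<t}" and fin: "finite B" and x: "x \<notin> cl (K \<union> b ` {..<t})"
    and xB: "x \<in> cl B" "x \<notin> B"
  obtains Y y where "Y \<subseteq> B" "y \<in> B" "chain (K \<union> Y) (b(t := y)) (g(t := x)) {..<Suc t}"
proof -
  define V where "V = K \<union> b ` {..<t}"
  let ?\<Y> = "{Y \<in> Pow B. rk (V \<union> Y) = rk V + card Y \<and> x \<notin> cl (V \<union> Y)}"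
  have ne: "?\<Y> \<noteq> {}" using x by (auto simp: V_def intro!: exI[of _ "{}"])
  have "finite ?\<Y>" by (rule finite_subset[of _ "Pow B"]) (use fin in auto)
  from finite_has_maximal[OF this ne] obtain Y
    where Y: "Y \<in> ?\<Y>" and max: "\<forall>Z\<in>?\<Y>. Y \<subseteq> Z \<longrightarrow> Y = Z" ..
  have finY: "finite Y" using Y fin finite_subset by auto
  have "\<not> B \<subseteq> cl (V \<union> Y)" using Y xB cl_trans by blast
  then obtain y where y: "y \<in> B" "y \<notin> cl (V \<union> Y)" by blast
  have yY: "y \<notin> Y" "y \<notin> V" using y subset_cl[of "V \<union> Y"] by auto
  have rkY: "rk (V \<union> insert y Y) = rk V + card (insert y Y)"
    using rk_insert_notin[OF y(2)] Y yY finY by simp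
  have "x \<in> cl (V \<union> insert y Y)"
  proof (rule ccontr)
    assume "x \<notin> cl (V \<union> insert y Y)"
    then have "insert y Y \<in> ?\<Y>" using Y y rkY by auto
    then show False using max yY by blast
  qed
  have skew: "e \<in> cl (K \<union> A)"
    if "e \<in> cl (K \<union> A \<union> insert y Y)" "e \<in> cl V" "A \<subseteq> b ` {..<t}" for e A
    by (rule cl_skew[OF _ rkY _ that(2,1)]) (use finY that subset_cl[of V] in \<open>auto simp: V_def\<close>)
  let ?b = "b(t := y)" and ?g = "g(t := x)" and ?K = "K \<union> Y"
  have "chain ?K ?b ?g {..<Suc t}"
    unfolding chain_def
  proof
    fix i assume i: "i \<in> {..<Suc t}"
    show "?b i \<notin> cl (?K \<union> ?b ` ({..<Suc t} - {i})) \<and> ?g i \<notin> cl (?K \<union> ?b ` ({..<Suc t} - {i})) \<and>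
      ?g i \<in> cl (?K \<union> ?b ` {j \<in> {..<Suc t}. j \<le> i}) \<and> ?b i \<noteq> ?g i"
    proof (cases "i = t")
      case True
      have "{..<Suc t} - {t} = {..<t}" by auto
      then have 1: "?K \<union> ?b ` ({..<Suc t} - {i}) = V \<union> Y" using True by (auto simp: V_def)
      have "{j. j < Suc t \<and> j \<le> t} = insert t {..<t}" by auto
      then have 2: "?K \<union> ?b ` {j \<in> {..<Suc t}. j \<le> i} = V \<union> insert y Y"
        using True by (auto simp: V_def)
      show ?thesis unfolding 1 2
        using True Y y xB \<open>x \<in> cl (V \<union> insert y Y)\<close> by auto
    next
      case False
      then have i: "i < t" using i by auto
      have *: "{..<Suc t} - {i} = insert t ({..<t} - {i})" using i by auto
      have 1: "?K \<union> ?b ` ({..<Suc t} - {i}) = K \<union> b ` ({..<t} - {i}) \<union> insert y Y"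
        unfolding * by auto
      have "{j \<in> {..<Suc t}. j \<le> i} = {j \<in> {..<t}. j \<le> i}" using i by auto
      then have 2: "K \<union> b ` {j \<in> {..<t}. j \<le> i} \<subseteq> ?K \<union> ?b ` {j \<in> {..<Suc t}. j \<le> i}"
        by auto
      have ci: "b i \<notin> cl (K \<union> b ` ({..<t} - {i}))" "g i \<notin> cl (K \<union> b ` ({..<t} - {i}))"
        "g i \<in> cl (K \<union> b ` {j \<in> {..<t}. j \<le> i})" "b i \<noteq> g i"
        using ch i by (auto simp: chain_def)
      have "b i \<in> cl V" using i subset_cl[of V] by (auto simp: V_def)
      moreover have "g i \<in> cl V" using ci(3) by (rule cl_monoD) (auto simp: V_def)
      ultimately have "b i \<notin> cl (K \<union> b ` ({..<t} - {i}) \<union> insert y Y)"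
        "g i \<notin> cl (K \<union> b ` ({..<t} - {i}) \<union> insert y Y)"
        using skew[of _ "b ` ({..<t} - {i})"] ci by blast+
      moreover have "g i \<in> cl (?K \<union> ?b ` {j \<in> {..<Suc t}. j \<le> i})"
        using ci(3) 2 by (rule cl_monoD)
      ultimately show ?thesis using 1 ci i by simp
    qed
  qed
  then show ?thesis using that Y y by blast
qed

text \<open>Each step costs a factor \<open>4 ^ s\<close> of \<open>card R\<close>. The chain
  confined to the smaller flat comes from the induction hypothesis, and an \<open>f i\<close>
  outside that flat becomes its last element. Confinement to \<open>cl B\<close> is part of the
  conclusion because the next step outwards needs it.\<close>

lemma chain_exists:
  fixes R :: "nat set"
  assumes no_uniform: "\<not> has_minor M (uniform s (2 * s))"
  shows "finite R \<Longrightarrow> finite B \<Longrightarrow> f ` R \<inter> B = {} \<Longrightarrow> \<forall>i\<in>R. f i \<notin> cl (f ` (R - {i})) \<Longrightarrow>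
    f ` R \<subseteq> cl B \<Longrightarrow> 4 ^ (s * t) \<le> card R \<Longrightarrow>
    \<exists>K b g. chain K b g {..<t} \<and> K \<union> b ` {..<t} \<subseteq> cl B"
proof (induction t arbitrary: B R)
  case 0
  have "chain {} f f {..<0}" by (simp add: chain_def)
  then show ?case by (metis empty_subsetI image_empty lessThan_0 sup_bot.right_neutral)
next
  case (Suc t)
  note finR = Suc.prems(1) and finB = Suc.prems(2) and disj = Suc.prems(3)
    and indep = Suc.prems(4) and span = Suc.prems(5)
  have inj: "inj_on f R"
  proof (rule inj_onI, rule ccontr)
    fix i j assume ij: "i \<in> R" "j \<in> R" "f i = f j" "i \<noteq> j"
    then have "f i \<in> f ` (R - {i})" by auto
    then show False using indep ij(1) subset_cl[of "f ` (R - {i})"] by auto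
  qed
  have rkR: "rk (f ` R) = card R"
    using rk_Un_image_indep[of R f "{}"] finR indep by simp
  have q: "4 ^ s * 4 ^ (s * t) \<le> card R" using Suc.prems by (simp add: power_add)
  have one_le: "(1::nat) \<le> 4 ^ (s * t)" by simp
  have "s < 4 ^ s" by (induction s) auto
  moreover have "(4::nat) ^ s * 1 \<le> 4 ^ s * 4 ^ (s * t)" by (intro mult_le_mono) auto
  ultimately have "s \<le> card R" using q by linarith
  have "f ` R \<in> indeps M"
    using rkR finR inj by (simp add: indep_iff_rk card_image)
  then obtain G where G: "basis_of M (f ` R \<union> B) G" "f ` R \<subseteq> G"
    using extend_to_basis[OF _ Un_upper1] by metis
  \<comment> \<open>\<open>C\<close> has rank \<open>rk B - card R\<close>, hence at most
    \<open>rk B - s\<close>. This leaves room for a subset \<open>B0\<close> of \<open>B\<close> of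
    corank exactly \<open>s\<close> whose closure still contains \<open>C\<close>; over
    \<open>B0\<close> the family then has rank at most \<open>s\<close>.\<close>
  define C where "C = G - f ` R"
  have C: "C \<subseteq> B" using G by (auto simp: C_def basis_of_def)
  have finG: "finite G" using G finite_indep by (auto simp: basis_of_def)
  have "C \<in> indeps M" using G indep_subset by (auto simp: C_def basis_of_def)
  then have "rk C = card G - card R"
    using rk_indep[of C] G(2) finG finR inj by (simp add: C_def card_Diff_subset card_image)
  moreover have rkB: "rk B = card G"
    using rk_Un_spanned[OF span] rk_basis[OF G(1)] by (simp add: Un_commute)
  moreover have "card R \<le> card G" using G(2) finG inj by (metis card_image card_mono)
  ultimately have "rk C \<le> rk B - s" "s \<le> rk B" using \<open>s \<le> card R\<close> by auto
  then have "\<exists>B0\<subseteq>B. rk B0 = rk B - s \<and> C \<subseteq> cl B0"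
    by (intro intermediate_rk[OF C]) auto
  then obtain B0 where B0: "B0 \<subseteq> B" "rk B0 = rk B - s" "C \<subseteq> cl B0"
    by (elim exE conjE)
  have "rk (B0 \<union> f ` R) \<le> rk B"
    using B0(1) span subset_cl[of B] by (intro rk_le_spanned) auto
  then have le: "rk (B0 \<union> f ` R) \<le> rk B0 + s" using B0 \<open>s \<le> rk B\<close> by simp
  obtain S where S: "S \<subseteq> R" "card S < s"
    "4 ^ (s * t) \<le> card {j \<in> R. (\<forall>i\<in>S. i < j) \<and> f j \<in> cl (B0 \<union> f ` S)}"
    using uniform_minor_or_dense_flat[OF finR inj q one_le le no_uniform] by (elim exE conjE)
  define J where "J = {j \<in> R. (\<forall>i\<in>S. i < j) \<and> f j \<in> cl (B0 \<union> f ` S)}"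
  let ?B = "B0 \<union> f ` S"
  have finS: "finite S" using S finR finite_subset by blast
  have "\<exists>K b g. chain K b g {..<t} \<and> K \<union> b ` {..<t} \<subseteq> cl ?B"
  proof (rule Suc.IH[of J])
    show "finite J" using finR by (simp add: J_def)
    show "finite ?B" using finS B0 finB finite_subset by auto
    show "f ` J \<inter> ?B = {}"
    proof -
      have "f ` J \<inter> f ` S = f ` (J \<inter> S)"
        using inj S by (subst inj_on_image_Int[of f R]) (auto simp: J_def)
      moreover have "J \<inter> S = {}" by (auto simp: J_def)
      ultimately show ?thesis using disj B0 by (auto simp: J_def)
    qed
    show "\<forall>i\<in>J. f i \<notin> cl (f ` (J - {i}))"
    proof
      fix i assume i: "i \<in> J"
      then have "f i \<notin> cl (f ` (R - {i}))" using indep by (auto simp: J_def)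
      then show "f i \<notin> cl (f ` (J - {i}))"
        by (rule contrapos_nn) (erule cl_monoD, auto simp: J_def)
    qed
    show "f ` J \<subseteq> cl ?B" by (auto simp: J_def)
    show "4 ^ (s * t) \<le> card J" using S by (simp add: J_def)
  qed
  then obtain K b g where IH: "chain K b g {..<t}" "K \<union> b ` {..<t} \<subseteq> cl ?B" by blast
  \<comment> \<open>The flat spanned by \<open>?B\<close> has smaller rank than \<open>B\<close> but contains \<open>C\<close>, which spans \<open>B\<close>
    together with \<open>f ` R\<close>.\<close>
  have "\<not> f ` R \<subseteq> cl ?B"
  proof
    assume "f ` R \<subseteq> cl ?B"
    moreover have "C \<subseteq> cl ?B" using B0(3) cl_mono[of B0 ?B] by auto
    moreover have "G \<subseteq> f ` R \<union> C" by (auto simp: C_def)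
    ultimately have "G \<subseteq> cl ?B" by (meson Un_least subset_trans)
    then have "rk G \<le> rk ?B" by (rule rk_le_spanned)
    moreover have "rk G = rk B" using G rkB rk_indep by (simp add: basis_of_def)
    ultimately show False
      using rk_Un_image_le[OF finS, of B0 f] S(2) B0(2) \<open>s \<le> rk B\<close> by simp
  qed
  then obtain i where i: "i \<in> R" "f i \<notin> cl ?B" by blast
  have BB: "cl ?B \<subseteq> cl B"
    using B0(1) S(1) span subset_cl[of B] by (intro cl_subset) auto
  obtain Y y where Y: "Y \<subseteq> B" "y \<in> B"
    "chain (K \<union> Y) (b(t := y)) (g(t := f i)) {..<Suc t}"
  proof (rule chain_extend[OF IH(1) finB])
    show "f i \<notin> cl (K \<union> b ` {..<t})" using i(2) IH(2) cl_subset by blast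
    show "f i \<in> cl B" "f i \<notin> B" using i span disj by auto
  qed
  have "(K \<union> Y) \<union> (b(t := y)) ` {..<Suc t} \<subseteq> cl B"
  proof -
    have "(b(t := y)) ` {..<Suc t} \<subseteq> insert y (b ` {..<t})" by (auto simp: less_Suc_eq)
    moreover have "K \<union> b ` {..<t} \<subseteq> cl B" using IH(2) BB by (rule subset_trans)
    moreover have "insert y Y \<subseteq> cl B" using Y(1,2) subset_cl[of B] by auto
    ultimately show ?thesis by auto
  qed
  then show ?case using Y(3) by (intro exI conjI)
qed

section \<open>Splitting parallel pairs off a triangular configuration\<close>

lemma initial_segment_exists:
  fixes I :: "nat set"
  assumes "finite I"
  shows "s \<le> card I \<Longrightarrow> \<exists>T\<subseteq>I. card T = s \<and> (\<forall>i\<in>T. \<forall>j\<in>I - T. i < j)"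
proof (induction s)
  case 0
  show ?case by (intro exI[of _ "{}"]) simp
next
  case (Suc s)
  then have "\<exists>T\<subseteq>I. card T = s \<and> (\<forall>i\<in>T. \<forall>j\<in>I - T. i < j)" by simp
  then obtain T where T: "T \<subseteq> I" "card T = s" "\<forall>i\<in>T. \<forall>j\<in>I - T. i < j"
    by (elim exE conjE)
  have finT: "finite T" using T assms finite_subset by blast
  have ne: "I - T \<noteq> {}" using T Suc.prems by auto
  define m where "m = Min (I - T)"
  have m: "m \<in> I - T" using Min_in[OF _ ne] assms by (simp add: m_def)
  have "m < j" if "j \<in> I - insert m T" for j
    using Min_le[of "I - T" j] that assms by (fastforce simp: m_def[symmetric])
  then show ?case using T m finT by (intro exI[of _ "insert m T"]) auto
qed

text \<open>\<open>Y\<close> is a maximal subset of the image of \<open>T\<close> that fails to span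
  this image over \<open>W\<close>. So \<open>W \<union> Y\<close> spans a hyperplane, to which any
  single missing \<open>b i\<close> adds everything; \<open>i\<close> is the least missing
  index.\<close>

lemma pivot_exists:
  fixes T :: "nat set"
  assumes finT: "finite T" and less: "rk W < rk (W \<union> b ` T)"
  shows "\<exists>Y i. Y \<subseteq> b ` T \<and> i \<in> T \<and> b i \<notin> cl (W \<union> Y) \<and>
    b ` {j \<in> T. j < i} \<subseteq> cl (W \<union> Y) \<and> b ` T \<subseteq> cl (insert (b i) (W \<union> Y))"
proof -
  let ?\<Y> = "{Y \<in> Pow (b ` T). \<not> b ` T \<subseteq> cl (W \<union> Y)}"
  have "\<not> b ` T \<subseteq> cl W" using rk_Un_spanned[of "b ` T" W] less by auto
  then have ne: "?\<Y> \<noteq> {}" by (auto intro!: exI[of _ "{}"])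
  have "finite ?\<Y>" by (rule finite_subset[of _ "Pow (b ` T)"]) (use finT in auto)
  from finite_has_maximal[OF this ne] obtain Y
    where Y: "Y \<in> ?\<Y>" and max: "\<forall>Z\<in>?\<Y>. Y \<subseteq> Z \<longrightarrow> Y = Z" ..
  let ?N = "{j \<in> T. b j \<notin> cl (W \<union> Y)}"
  have finN: "finite ?N" using finT by simp
  have neN: "?N \<noteq> {}" using Y by auto
  define i where "i = Min ?N"
  have "i \<in> ?N" unfolding i_def using finN neN by (rule Min_in)
  then have i: "i \<in> T" "b i \<notin> cl (W \<union> Y)" by auto
  have low: "b j \<in> cl (W \<union> Y)" if "j \<in> T" "j < i" for j
    using Min_le[OF finN, of j] that by (auto simp: i_def[symmetric])
  have "b ` T \<subseteq> cl (W \<union> insert (b i) Y)"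
  proof (rule ccontr)
    assume "\<not> b ` T \<subseteq> cl (W \<union> insert (b i) Y)"
    then have "insert (b i) Y \<in> ?\<Y>" using i(1) Y by simp
    then have "Y = insert (b i) Y" using max by blast
    then have "b i \<in> Y" by blast
    then show False using i(2) subset_cl[of "W \<union> Y"] by auto
  qed
  then show ?thesis using Y i low by (intro exI[of _ Y] exI[of _ i]) auto
qed

text \<open>
  The first \<open>s\<close> indices \<open>T\<close> are left uncontracted, so that the remaining \<open>f j\<close> have rank at most \<open>s\<close>
  over \<open>K \<union> b ` (I - T)\<close> and many of them lie in the span of fewer than \<open>s\<close>. This span extends to a
  hyperplane avoiding some \<open>b i\<close> with \<open>i \<in> T\<close>; taking the least such \<open>i\<close> puts \<open>f i\<close>, too, outside of it.
\<close>

lemma chain_split: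
  fixes I :: "nat set"
  assumes ch: "chain K b f I" and finI: "finite I"
    and size: "s + 4 ^ s * q \<le> card I" and q: "1 \<le> q"
    and no_uniform: "\<not> has_minor M (uniform s (2 * s))"
  shows "\<exists>i\<in>I. \<exists>J\<subseteq>I - {i}. \<exists>C. q \<le> card J \<and> K \<subseteq> C \<and> chain C b f J \<and>
    C \<union> b ` J \<subseteq> cl (K \<union> b ` I) \<and>
    b i \<notin> cl (C \<union> b ` J) \<and> f i \<notin> cl (C \<union> b ` J) \<and> f i \<in> cl (insert (b i) C)"
proof -
  have b_notin: "b i \<notin> cl (K \<union> b ` (I - {i}))" and f_notin: "f i \<notin> cl (K \<union> b ` (I - {i}))"
    and f_in: "f i \<in> cl (K \<union> b ` {j \<in> I. j \<le> i})" if "i \<in> I" for i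
    using ch that by (auto simp: chain_def)
  have rkI: "rk (K \<union> b ` I) = rk K + card I" using finI ch by (rule chain_rk)
  have fI: "f ` I \<subseteq> cl (K \<union> b ` I)"
  proof (rule image_subsetI)
    fix i assume "i \<in> I"
    then show "f i \<in> cl (K \<union> b ` I)" by (rule f_in[THEN cl_monoD]) auto
  qed
  have "\<exists>T\<subseteq>I. card T = s \<and> (\<forall>i\<in>T. \<forall>j\<in>I - T. i < j)"
    using finI size by (intro initial_segment_exists) auto
  then obtain T where T: "T \<subseteq> I" "card T = s" "\<forall>i\<in>T. \<forall>j\<in>I - T. i < j"
    by (elim exE conjE)
  have finT: "finite T" using T finI finite_subset by blast
  define R where "R = I - T"
  have R: "finite R" "R \<subseteq> I" "T \<inter> R = {}" "T \<union> R = I" "card I = s + card R"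
    using finI finT T card_mono[OF finI T(1)] by (auto simp: R_def card_Diff_subset)
  have TR: "i < j" if "i \<in> T" "j \<in> R" for i j using T(3) that by (auto simp: R_def)
  let ?K = "K \<union> b ` R"
  have KI: "?K \<union> b ` T = K \<union> b ` I" using R(4) by auto
  have le: "rk (?K \<union> f ` R) \<le> rk ?K + s"
  proof -
    have "rk (?K \<union> f ` R) \<le> rk (K \<union> b ` I)"
      using R(2) fI subset_cl[of "K \<union> b ` I"] by (intro rk_le_spanned) blast
    then show ?thesis using rk_Un_image_le[OF finT, of ?K b] KI T(2) by simp
  qed
  have qR: "4 ^ s * q \<le> card R" using size R(5) by simp
  have injR: "inj_on f R" using inj_on_chain[OF ch] R(2) by (rule inj_on_subset)
  obtain S where S: "S \<subseteq> R" "card S < s"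
    "q \<le> card {j \<in> R. (\<forall>i\<in>S. i < j) \<and> f j \<in> cl (?K \<union> f ` S)}"
    using uniform_minor_or_dense_flat[OF R(1) injR qR q le no_uniform] by (elim exE conjE)
  have finS: "finite S" using S(1) R(1) by (rule finite_subset)
  define W where "W = ?K \<union> f ` S"
  have Wspan: "W \<subseteq> cl (K \<union> b ` I)"
    using R(2) S(1) fI subset_cl[of "K \<union> b ` I"] unfolding W_def by blast
  have WT: "rk (W \<union> b ` T) = rk (K \<union> b ` I)"
  proof (rule antisym)
    show "rk (W \<union> b ` T) \<le> rk (K \<union> b ` I)"
      using Wspan T(1) subset_cl[of "K \<union> b ` I"] by (intro rk_le_spanned) blast
    show "rk (K \<union> b ` I) \<le> rk (W \<union> b ` T)"
      using KI by (intro rk_mono) (auto simp: W_def)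
  qed
  \<comment> \<open>Over \<open>K\<close>, the set \<open>W\<close> is generated by
    \<open>card R\<close> elements and fewer than \<open>s\<close> further ones, whereas the whole
    chain has rank \<open>card R + s\<close>.\<close>
  have "rk W < rk (W \<union> b ` T)"
    using rk_Un_image_le[OF finS, of ?K f] rk_Un_image_le[OF R(1), of K b] S(2) R(5) rkI WT
    unfolding W_def by linarith
  then have "\<exists>Y i. Y \<subseteq> b ` T \<and> i \<in> T \<and> b i \<notin> cl (W \<union> Y) \<and>
    b ` {j \<in> T. j < i} \<subseteq> cl (W \<union> Y) \<and> b ` T \<subseteq> cl (insert (b i) (W \<union> Y))"
    by (rule pivot_exists[OF finT])
  then obtain Y i where Y: "Y \<subseteq> b ` T" and i: "i \<in> T" and biA: "b i \<notin> cl (W \<union> Y)"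
    and low: "b ` {j \<in> T. j < i} \<subseteq> cl (W \<union> Y)"
    and top: "b ` T \<subseteq> cl (insert (b i) (W \<union> Y))"
    by (elim exE conjE)
  define A where "A = W \<union> Y"
  have iI: "i \<in> I" using i T(1) by blast
  have KA: "K \<union> b ` R \<subseteq> A" by (auto simp: A_def W_def)
  have Aspan: "A \<subseteq> cl (K \<union> b ` I)"
    using Wspan Y T(1) subset_cl[of "K \<union> b ` I"] unfolding A_def by blast
  \<comment> \<open>\<open>A\<close> spans a hyperplane in the span of \<open>K\<close> and the
    whole chain. All rank counts below rest on this corank of one.\<close>
  have rkA: "rk (insert (b i) A) = rk K + card I" "Suc (rk A) = rk K + card I"
  proof -
    have "W \<union> b ` T \<subseteq> cl (insert (b i) A)"
      using top subset_cl[of "insert (b i) A"] unfolding A_def by blast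
    then have "rk (K \<union> b ` I) \<le> rk (insert (b i) A)"
      using rk_le_spanned WT by metis
    moreover have "rk (insert (b i) A) \<le> rk (K \<union> b ` I)"
      using Aspan iI subset_cl[of "K \<union> b ` I"] by (intro rk_le_spanned) blast
    ultimately show "rk (insert (b i) A) = rk K + card I" using rkI by simp
    then show "Suc (rk A) = rk K + card I"
      using rk_insert_notin[of "b i" A] biA by (simp add: A_def)
  qed
  \<comment> \<open>Here the minimality of \<open>i\<close> enters: the \<open>b j\<close> with
    \<open>j < i\<close> lie in the hyperplane, so if \<open>f i\<close> did too, exchange would
    pull \<open>b i\<close> into it.\<close>
  have fiA: "f i \<notin> cl A"
  proof
    assume fi: "f i \<in> cl A"
    let ?X = "K \<union> b ` {j \<in> T. j < i}"
    have "{j \<in> I. j \<le> i} \<subseteq> insert i {j \<in> T. j < i}"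
      using TR[OF i] R(4) by fastforce
    then have "f i \<in> cl (insert (b i) ?X)"
      using f_in[OF iI] by (elim cl_monoD) blast
    moreover have "f i \<notin> cl ?X"
      using f_notin[OF iI] by (rule contrapos_nn) (erule cl_monoD, use T(1) in blast)
    ultimately have "b i \<in> cl (insert (f i) ?X)" by (rule exchange)
    moreover have "insert (f i) ?X \<subseteq> cl A"
      using fi low KA subset_cl[of A] unfolding A_def by blast
    ultimately show False using biA cl_trans unfolding A_def by blast
  qed
  \<comment> \<open>\<open>L\<close> consists of the indices of \<open>R\<close> up to the largest
    member of \<open>S\<close>. By triangularity the \<open>f k\<close> with
    \<open>k \<in> S\<close> involve only indices in \<open>T \<union> L\<close>, so
    \<open>C\<close> lies in the span of \<open>V\<close>, away from \<open>U\<close>.\<close>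
  define L where "L = {j \<in> R. \<exists>k\<in>S. j \<le> k}"
  define U where "U = R - L"
  have LU: "finite L" "finite U" "L \<inter> U = {}" "L \<union> U = R" "card R = card L + card U"
  proof -
    show "finite L" "finite U" using R(1) by (auto simp: L_def U_def)
    show "L \<inter> U = {}" "L \<union> U = R" by (auto simp: L_def U_def)
    then show "card R = card L + card U" using \<open>finite L\<close> \<open>finite U\<close> card_Un_disjoint by metis
  qed
  define C where "C = K \<union> b ` L \<union> f ` S \<union> Y"
  have A: "A = C \<union> b ` U" using LU(4) by (auto simp: A_def W_def C_def)
  have CA: "C \<subseteq> A" by (simp add: A)
  define V where "V = K \<union> b ` (T \<union> L)"
  have rkV: "rk V \<le> rk K + s + card L"
  proof -
    have "card (T \<union> L) = s + card L"
      using LU(1,4) finT T(2) R(3) by (subst card_Un_disjoint) auto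
    then show ?thesis using rk_Un_image_le[of "T \<union> L" K b] finT LU(1) by (simp add: V_def)
  qed
  have CV: "C \<subseteq> cl V"
  proof -
    have "f ` S \<subseteq> cl V"
    proof (rule image_subsetI)
      fix k assume k: "k \<in> S"
      then have "f k \<in> cl (K \<union> b ` {j \<in> I. j \<le> k})" using f_in S(1) R(2) by blast
      then show "f k \<in> cl V"
        by (rule cl_monoD) (use k R(4) in \<open>auto simp: V_def L_def\<close>)
    qed
    moreover have "K \<union> b ` L \<union> Y \<subseteq> V" using Y by (auto simp: V_def)
    ultimately show ?thesis using subset_cl[of V] by (auto simp: C_def)
  qed
  have biV: "b i \<in> V" using i by (auto simp: V_def)
  have rkAC: "rk (insert (b i) A) \<le> rk (insert (b i) C) + card U"
    using rk_Un_image_le[OF LU(2), of "insert (b i) C" b] by (simp add: A)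
  \<comment> \<open>Adding \<open>b i\<close> to \<open>A\<close> gives full rank, of which
    \<open>U\<close> contributes at most \<open>card U\<close>. What remains for \<open>b i\<close>
    and \<open>C\<close> is at least the rank of \<open>V\<close>, so they span \<open>V\<close> and
    with it \<open>f i\<close>.\<close>
  have fiC: "f i \<in> cl (insert (b i) C)"
  proof -
    have "cl V \<subseteq> cl (insert (b i) C)"
    proof (rule subset_cl_of_rk_le)
      show "insert (b i) C \<subseteq> cl V" using CV biV subset_cl[of V] by blast
      show "rk V \<le> rk (insert (b i) C)"
        using rkV rkAC rkA(1) R(5) LU(5) by linarith
    qed
    moreover have "f i \<in> cl V"
      using f_in[OF iI]
    proof (rule cl_monoD)
      have "{j \<in> I. j \<le> i} \<subseteq> T" using TR[OF i] R(4) by fastforce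
      then show "K \<union> b ` {j \<in> I. j \<le> i} \<subseteq> V" by (auto simp: V_def)
    qed
    ultimately show ?thesis by blast
  qed
  have rkC: "Suc (rk C) \<le> rk K + s + card L"
  proof -
    have "b i \<notin> cl C" using biA cl_mono[OF CA] unfolding A_def by blast
    then have "Suc (rk C) = rk (insert (b i) C)" by (simp add: rk_insert_notin)
    also have "\<dots> \<le> rk V" using CV biV subset_cl[of V] by (intro rk_le_spanned) blast
    finally show ?thesis using rkV by simp
  qed
  define J where "J = {j \<in> R. (\<forall>i\<in>S. i < j) \<and> f j \<in> cl (?K \<union> f ` S)}"
  have JU: "J \<subseteq> U" by (auto simp: J_def U_def L_def)
  have fJA: "f j \<in> cl A" if "j \<in> J" for j
    by (rule cl_monoD[of "f j" W A]) (use that in \<open>simp_all add: J_def W_def A_def\<close>)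
  \<comment> \<open>The part of \<open>U\<close> outside the dense flat is contracted too, so that
    exactly the indices in \<open>J\<close> survive.\<close>
  let ?C = "C \<union> b ` (U - J)"
  have CJ: "?C \<union> b ` J = A" using JU by (auto simp: A)
  have "chain ?C b f J"
    unfolding chain_def
  proof (intro ballI conjI)
    fix j assume j: "j \<in> J"
    then have jI: "j \<in> I" "j \<in> U" "j \<in> R" using JU LU(4) R(2) by auto
    have ij: "i < j" using TR i jI by blast
    let ?Z = "?C \<union> b ` (J - {j})"
    have Z: "?Z = C \<union> b ` (U - {j})" using JU j by auto
    \<comment> \<open>If \<open>b j\<close> were redundant, \<open>C\<close> and the other
      \<open>card U - 1\<close> elements would span \<open>A\<close>; but \<open>C\<close> has
      corank at least one below \<open>rk K + s + card L\<close>, so the rank of \<open>A\<close>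
      would be too small.\<close>
    show bj: "b j \<notin> cl ?Z"
    proof
      assume "b j \<in> cl ?Z"
      then have "rk (insert (b j) ?Z) = rk ?Z" by (simp add: cl_def)
      moreover have "insert (b j) ?Z = A" using jI by (auto simp: A Z)
      ultimately have "rk A = rk ?Z" by simp
      moreover have "rk ?Z \<le> rk C + (card U - 1)"
        using rk_Un_image_le[of "U - {j}" C b] LU(2) jI Z by (simp add: card_Diff_singleton)
      moreover have "card U \<ge> 1" using jI LU(2) card_gt_0_iff[of U] by fastforce
      ultimately show False using rkA(2) rkC R(5) LU(5) by linarith
    qed
    let ?X = "C \<union> b ` {l \<in> U. l \<le> j}" and ?X' = "C \<union> b ` {l \<in> U. l < j}"
    \<comment> \<open>Otherwise \<open>f j\<close> and then \<open>b i\<close> would each raise the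
      rank of \<open>?X\<close> within the span of \<open>?V\<close>. Each index of \<open>U\<close>
      above \<open>j\<close> adds at most one to the rank, so \<open>A\<close> would have corank at
      least two in the whole.\<close>
    have fX: "f j \<in> cl ?X"
    proof (rule ccontr)
      assume fj: "f j \<notin> cl ?X"
      let ?V = "K \<union> b ` {l \<in> I. l \<le> j}"
      have TL: "T \<union> L \<subseteq> {l \<in> I. l \<le> j}"
        using j T(1) R(2) TR jI by (fastforce simp: L_def J_def)
      have Vspan: "insert (b i) (insert (f j) ?X) \<subseteq> cl ?V"
      proof -
        have "cl V \<subseteq> cl ?V" using TL by (intro cl_mono) (auto simp: V_def)
        moreover have "b i \<in> ?V" "b ` {l \<in> U. l \<le> j} \<subseteq> ?V"
          using ij iI LU(4) R(2) by auto
        ultimately show ?thesis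
          using CV f_in[OF jI(1)] subset_cl[of ?V] by blast
      qed
      have "{l \<in> I. l \<le> j} \<subseteq> (T \<union> L) \<union> {l \<in> U. l \<le> j}" using R(4) LU(4) by auto
      then have "card {l \<in> I. l \<le> j} \<le> card ((T \<union> L) \<union> {l \<in> U. l \<le> j})"
        using finT LU by (intro card_mono) auto
      also have "\<dots> \<le> s + card L + card {l \<in> U. l \<le> j}"
        using card_Un_le[of "T \<union> L" "{l \<in> U. l \<le> j}"] card_Un_le[of T L] T(2) by linarith
      finally have "card {l \<in> I. l \<le> j} \<le> s + card L + card {l \<in> U. l \<le> j}" .
      then have up: "rk ?V \<le> rk K + (s + card L + card {l \<in> U. l \<le> j})"
        using rk_Un_image_le[of "{l \<in> I. l \<le> j}" K b] finI by simp
      have "insert (f j) ?X \<subseteq> cl A"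
        using fJA[OF j] subset_cl[of A] by (auto simp: A)
      then have "b i \<notin> cl (insert (f j) ?X)"
        using biA cl_trans unfolding A_def by blast
      then have "rk (insert (b i) (insert (f j) ?X)) = Suc (Suc (rk ?X))"
        using fj by (simp add: rk_insert_notin)
      then have "Suc (Suc (rk ?X)) \<le> rk ?V" using rk_le_spanned[OF Vspan] by simp
      moreover have "rk A \<le> rk ?X + card {l \<in> U. \<not> l \<le> j}"
      proof -
        have "A = ?X \<union> b ` {l \<in> U. \<not> l \<le> j}" by (auto simp: A)
        then show ?thesis
          using rk_Un_image_le[of "{l \<in> U. \<not> l \<le> j}" ?X b] LU(2) by simp
      qed
      moreover have "card U = card {l \<in> U. l \<le> j} + card {l \<in> U. \<not> l \<le> j}"
      proof -
        have "U = {l \<in> U. l \<le> j} \<union> {l \<in> U. \<not> l \<le> j}" by auto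
        then have "card U = card ({l \<in> U. l \<le> j} \<union> {l \<in> U. \<not> l \<le> j})" by simp
        also have "\<dots> = card {l \<in> U. l \<le> j} + card {l \<in> U. \<not> l \<le> j}"
          using LU(2) by (intro card_Un_disjoint) auto
        finally show ?thesis .
      qed
      ultimately show False using up rkA(2) R(5) LU(5) by linarith
    qed
    then show "f j \<in> cl (?C \<union> b ` {l \<in> J. l \<le> j})"
      by (rule cl_monoD) auto
    \<comment> \<open>Modulo \<open>?X'\<close>, the elements \<open>f j\<close> and
      \<open>b j\<close> are exchangeable, so spanning \<open>f j\<close> would mean spanning
      \<open>b j\<close>, which was just excluded.\<close>
    show "f j \<notin> cl ?Z"
    proof
      assume fZ: "f j \<in> cl ?Z"
      have "{l \<in> U. l \<le> j} \<subseteq> insert j {l \<in> U. l < j}" by auto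
      then have "f j \<in> cl (insert (b j) ?X')"
        using fX by (elim cl_monoD) blast
      moreover have "f j \<notin> cl ?X'"
      proof
        have "T \<union> L \<subseteq> I - {j}"
          using j T(1) R(2) TR jI by (fastforce simp: L_def J_def)
        then have "V \<subseteq> K \<union> b ` (I - {j})" by (auto simp: V_def)
        moreover have "b ` {l \<in> U. l < j} \<subseteq> K \<union> b ` (I - {j})" using LU(4) R(2) by auto
        ultimately have "?X' \<subseteq> cl (K \<union> b ` (I - {j}))"
          using CV cl_mono[of V] subset_cl[of "K \<union> b ` (I - {j})"] by blast
        moreover assume "f j \<in> cl ?X'"
        ultimately show False using f_notin[OF jI(1)] cl_trans by blast
      qed
      ultimately have "b j \<in> cl (insert (f j) ?X')" by (rule exchange)
      moreover have "?X' \<subseteq> ?Z" unfolding Z by auto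
      then have "insert (f j) ?X' \<subseteq> cl ?Z" using fZ subset_cl[of ?Z] by blast
      ultimately show False using bj cl_trans by blast
    qed
    show "b j \<noteq> f j" using ch jI(1) by (simp add: chain_def)
  qed
  moreover have "J \<subseteq> I - {i}" using JU LU(4) R(2,3) i by auto
  moreover have "q \<le> card J" using S(3) by (simp add: J_def)
  moreover have "K \<subseteq> ?C" by (auto simp: C_def)
  moreover have "f i \<in> cl (insert (b i) ?C)" using fiC by (rule cl_monoD) auto
  ultimately show ?thesis
    using iI Aspan biA fiA CJ unfolding A_def[symmetric]
    by (intro bexI[of _ i] exI[of _ J] exI[of _ ?C] conjI) simp_all
qed

text \<open>One split shrinks length \<open>(4 ^ s + s) * q\<close>, which is at least
  \<open>s + 4 ^ s * q\<close>, to \<open>q\<close>. The span clause drives the induction: all later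
  choices stay in the flat that avoids \<open>b i\<close> and \<open>f i\<close>, so the pair split
  off can be put back at the end.\<close>

lemma matching_exists:
  assumes no_uniform: "\<not> has_minor M (uniform s (2 * s))"
  shows "finite I \<Longrightarrow> chain K b f I \<Longrightarrow> (4 ^ s + s) ^ a \<le> card I \<Longrightarrow>
    \<exists>K' I'. K \<subseteq> K' \<and> I' \<subseteq> I \<and> card I' = a \<and> K' \<union> b ` I' \<subseteq> cl (K \<union> b ` I) \<and>
      chain K' b f I' \<and> (\<forall>i\<in>I'. f i \<in> cl (insert (b i) K'))"
proof (induction a arbitrary: K I)
  case 0
  show ?case
    using subset_cl[of "K \<union> b ` I"] by (intro exI[of _ K] exI[of _ "{}"]) (auto simp: chain_def)
next
  case (Suc a)
  let ?q = "(4 ^ s + s) ^ a"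
  have "0 < ?q" by (intro zero_less_power) simp
  then have q: "1 \<le> ?q" by linarith
  then have "s * 1 \<le> s * ?q" by (intro mult_le_mono2)
  then have "s + 4 ^ s * ?q \<le> (4 ^ s + s) * ?q" unfolding add_mult_distrib by linarith
  then have size: "s + 4 ^ s * ?q \<le> card I" using Suc.prems(3) by simp
  obtain i J C where i: "i \<in> I" and J: "J \<subseteq> I - {i}" "?q \<le> card J" and KC: "K \<subseteq> C"
    and C: "chain C b f J" "C \<union> b ` J \<subseteq> cl (K \<union> b ` I)"
    and bi: "b i \<notin> cl (C \<union> b ` J)" and fi: "f i \<notin> cl (C \<union> b ` J)" "f i \<in> cl (insert (b i) C)"
    using chain_split[OF Suc.prems(2,1) size q no_uniform] by (elim bexE exE conjE)
  have finJ: "finite J" using J(1) Suc.prems(1) by (meson finite_Diff finite_subset)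
  obtain K' I' where CK': "C \<subseteq> K'" and I': "I' \<subseteq> J" "card I' = a"
    and span: "K' \<union> b ` I' \<subseteq> cl (C \<union> b ` J)" and ch': "chain K' b f I'"
    and match: "\<forall>j\<in>I'. f j \<in> cl (insert (b j) K')"
    using Suc.IH[OF finJ C(1) J(2)] by (elim exE conjE)
  have iI': "i \<notin> I'" using I' J by auto
  have finI': "finite I'" using I'(1) finJ by (rule finite_subset)
  let ?I = "insert i I'"
  have fI': "f j \<in> cl (C \<union> b ` J)" if "j \<in> I'" for j
  proof -
    have "insert (b j) K' \<subseteq> cl (C \<union> b ` J)" using span that by auto
    then show ?thesis using match that cl_trans by blast
  qed
  \<comment> \<open>If putting \<open>b i\<close> back made \<open>e\<close> spanned, exchange would
    force \<open>b i\<close> into the flat that avoids it.\<close>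
  have keep: "e \<notin> cl (K' \<union> b ` (?I - {j}))"
    if "e \<notin> cl (K' \<union> b ` (I' - {j}))" "e \<in> cl (C \<union> b ` J)" "j \<in> I'" for e j
  proof
    let ?X = "K' \<union> b ` (I' - {j})"
    assume "e \<in> cl (K' \<union> b ` (?I - {j}))"
    moreover have "K' \<union> b ` (?I - {j}) = insert (b i) ?X" using that iI' by auto
    ultimately have "b i \<in> cl (insert e ?X)" using that(1) exchange by simp
    moreover have "insert e ?X \<subseteq> cl (C \<union> b ` J)" using that span by auto
    ultimately show False using bi cl_trans by blast
  qed
  have "chain K' b f ?I"
    unfolding chain_def
  proof (intro ballI)
    fix j assume j: "j \<in> ?I"
    show "b j \<notin> cl (K' \<union> b ` (?I - {j})) \<and> f j \<notin> cl (K' \<union> b ` (?I - {j})) \<and>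
      f j \<in> cl (K' \<union> b ` {l \<in> ?I. l \<le> j}) \<and> b j \<noteq> f j"
    proof (cases "j = i")
      case True
      have "?I - {i} = I'" using iI' by auto
      moreover have "f i \<in> cl (K' \<union> b ` {l \<in> ?I. l \<le> i})"
        using fi(2) by (rule cl_monoD) (use CK' in auto)
      moreover have "b i \<noteq> f i" using Suc.prems(2) i by (simp add: chain_def)
      ultimately show ?thesis using True bi fi(1) span cl_trans by metis
    next
      case False
      then have jI': "j \<in> I'" using j by simp
      have "b j \<in> cl (C \<union> b ` J)" using span jI' by auto
      moreover have "f j \<in> cl (K' \<union> b ` {l \<in> ?I. l \<le> j})"
        by (rule cl_monoD[of "f j" "insert (b j) K'"]) (use match jI' in auto)
      ultimately show ?thesis
        using keep[of "b j" j] keep[of "f j" j] fI' jI' ch' by (simp add: chain_def)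
    qed
  qed
  moreover have "f j \<in> cl (insert (b j) K')" if "j \<in> ?I" for j
  proof (cases "j = i")
    case True
    have "f i \<in> cl (insert (b i) K')" using fi(2) by (rule cl_monoD) (use CK' in auto)
    then show ?thesis using True by simp
  qed (use that match in simp)
  moreover have "K' \<union> b ` ?I \<subseteq> cl (K \<union> b ` I)"
  proof -
    have "K' \<union> b ` I' \<subseteq> cl (K \<union> b ` I)" using span cl_subset[OF C(2)] by (rule subset_trans)
    moreover have "b i \<in> cl (K \<union> b ` I)" using i subset_cl[of "K \<union> b ` I"] by auto
    ultimately show ?thesis by simp
  qed
  moreover have "?I \<subseteq> I" using i I' J by auto
  moreover have "card ?I = Suc a" using finI' iI' I' by simp
  ultimately show ?case using KC CK' by (intro exI[of _ K'] exI[of _ ?I]) simp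
qed

section \<open>From matched pairs to a direct sum of copies of U_{1,2}\<close>

text \<open>For each pair, the span of \<open>K\<close> and the other \<open>b j\<close> contains
  all other pairs but neither element of this one. Together with parallelism inside the pair, this
  makes a set independent over \<open>K\<close> exactly when it meets every pair at most
  once.\<close>

lemma has_minor_copiesI:
  assumes finI: "finite I" "card I = s" and ch: "chain K b f I"
    and match: "\<forall>i\<in>I. f i \<in> cl (insert (b i) K)"
  shows "has_minor M (copies s (uniform 1 2))"
proof -
  obtain h where h: "bij_betw h {..<s} I"
    using ex_bij_betw_nat_finite[OF finI(1)] finI(2) by (auto simp: atLeast0LessThan)
  have hI: "h k \<in> I" if "k < s" for k using h that by (auto simp: bij_betw_def)
  have h_eq: "h k = h l \<longleftrightarrow> k = l" if "k < s" "l < s" for k l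
    using h that by (auto simp: bij_betw_def inj_on_def)
  \<comment> \<open>The tag 0 stands for \<open>b\<close>, the tag 1 for \<open>f\<close>; the
    inverse of this labelling will be the isomorphism.\<close>
  define \<phi> where "\<phi> = (\<lambda>(k, c). if c = (0::nat) then b (h k) else f (h k))"
  define G where "G = {..<s} \<times> {..<2::nat}"
  have finG: "finite G" by (simp add: G_def)
  have notin: "\<phi> (k, c) \<notin> cl (K \<union> b ` (I - {h k}))" if "k < s" for k c
    using ch hI[OF that] by (simp add: chain_def \<phi>_def)
  have isin: "\<phi> (l, c) \<in> cl (K \<union> b ` (I - {h k}))" if "k < s" "l < s" "k \<noteq> l" for k l c
  proof -
    have "\<phi> (l, c) \<in> cl (insert (b (h l)) K)"
      using match hI[OF that(2)] subset_cl[of "insert (b (h l)) K"] by (auto simp: \<phi>_def)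
    then show ?thesis by (rule cl_monoD) (use that hI h_eq in auto)
  qed
  have inj: "inj_on \<phi> G"
  proof (rule inj_onI)
    fix x y assume xy: "x \<in> G" "y \<in> G" "\<phi> x = \<phi> y"
    obtain k c l d where eq: "x = (k, c)" "y = (l, d)" by (cases x, cases y)
    then have kl: "k < s" "l < s" "c < 2" "d < 2" using xy by (auto simp: G_def)
    have "k = l" using notin[of k c] isin[of k l d] xy(3) eq kl by auto
    moreover have "b (h k) \<noteq> f (h k)" using ch hI[of k] kl by (simp add: chain_def)
    then have "c = d" using xy(3) eq kl \<open>k = l\<close> by (auto simp: \<phi>_def split: if_splits)
    ultimately show "x = y" using eq by simp
  qed
  have sub: "\<phi> ` G \<subseteq> ground M - K"
  proof (rule image_subsetI)
    fix x assume "x \<in> G"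
    then have "\<phi> x \<notin> cl (K \<union> b ` (I - {h (fst x)}))"
      using notin[of "fst x" "snd x"] by (auto simp: G_def)
    moreover from this have "\<phi> x \<notin> K"
      using subset_cl[of "K \<union> b ` (I - {h (fst x)})"] by auto
    ultimately show "\<phi> x \<in> ground M - K" using notin_cl_in_ground by auto
  qed
  obtain N where N: "is_minor N M" "ground N = \<phi> ` G"
    "\<forall>X\<subseteq>\<phi> ` G. X \<in> indeps N \<longleftrightarrow> rk (K \<union> X) = rk K + card X"
    using minor_exists[OF sub] by (elim exE conjE)
  have indep: "\<phi> ` X \<in> indeps N \<longleftrightarrow> (\<forall>k<s. card (X `` {k}) \<le> 1)" if X: "X \<subseteq> G" for X
  proof -
    have finX: "finite X" using X finG by (rule finite_subset)
    have "\<phi> ` X \<in> indeps N \<longleftrightarrow> rk (K \<union> \<phi> ` X) = rk K + card (\<phi> ` X)"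
      using N(3) image_mono[OF X, of \<phi>] by simp
    also have "\<dots> \<longleftrightarrow> (\<forall>k<s. card (X `` {k}) \<le> 1)"
    proof
      assume eq: "rk (K \<union> \<phi> ` X) = rk K + card (\<phi> ` X)"
      show "\<forall>k<s. card (X `` {k}) \<le> 1"
      proof (intro allI impI, rule ccontr)
        fix k assume k: "k < s" and large: "\<not> card (X `` {k}) \<le> 1"
        have "X `` {k} \<subseteq> {..<2}" using X by (auto simp: G_def)
        moreover have "card {..<2::nat} \<le> card (X `` {k})" using large by simp
        ultimately have "X `` {k} = {..<2}" by (intro card_seteq) simp_all
        moreover have "0 \<in> {..<2::nat}" "1 \<in> {..<2::nat}" by simp_all
        ultimately have "0 \<in> X `` {k}" "1 \<in> X `` {k}" by (simp_all only:)
        then have X01: "(k, 0) \<in> X" "(k, 1) \<in> X" by simp_all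
        have "f (h k) = \<phi> (k, 1)" "b (h k) = \<phi> (k, 0)" by (simp_all add: \<phi>_def)
        then have f: "f (h k) \<in> \<phi> ` X" and bX: "b (h k) \<in> \<phi> ` X"
          using X01 by (simp_all only: imageI)
        have ne: "b (h k) \<noteq> f (h k)" using ch hI[OF k] by (simp add: chain_def)
        have "f (h k) \<in> cl (insert (b (h k)) K)" using match hI[OF k] by blast
        then have "f (h k) \<in> cl (K \<union> (\<phi> ` X - {f (h k)}))"
          by (rule cl_monoD) (use bX ne in auto)
        then show False using notin_cl_of_rk_Un[OF _ eq f] finX by simp
      qed
    next
      assume le: "\<forall>k<s. card (X `` {k}) \<le> 1"
      have "\<forall>x\<in>X. \<phi> x \<notin> cl (K \<union> \<phi> ` (X - {x}))"
      proof (intro ballI notI)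
        fix x assume x: "x \<in> X" and cl: "\<phi> x \<in> cl (K \<union> \<phi> ` (X - {x}))"
        obtain k c where kc: "x = (k, c)" by (cases x)
        have k: "k < s" using x kc X by (auto simp: G_def)
        have "finite (X `` {k})" using finX by (rule finite_Image)
        then have "X `` {k} = {c}"
          using le k x kc by (intro card_seteq[symmetric]) auto
        have "\<phi> ` (X - {x}) \<subseteq> cl (K \<union> b ` (I - {h k}))"
        proof (rule image_subsetI)
          fix y assume y: "y \<in> X - {x}"
          obtain l d where ld: "y = (l, d)" by (cases y)
          have "l < s" using y ld X by (auto simp: G_def)
          moreover have "k \<noteq> l" using y ld kc \<open>X `` {k} = {c}\<close> by auto
          ultimately show "\<phi> y \<in> cl (K \<union> b ` (I - {h k}))" using isin[OF k] ld by simp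
        qed
        then have "K \<union> \<phi> ` (X - {x}) \<subseteq> cl (K \<union> b ` (I - {h k}))"
          using subset_cl[of "K \<union> b ` (I - {h k})"] by auto
        then show False using notin[OF k] cl kc cl_trans by metis
      qed
      then have "rk (K \<union> \<phi> ` X) = rk K + card X" using finX by (intro rk_Un_image_indep)
      also have "card X = card (\<phi> ` X)"
        using inj_on_subset[OF inj X] by (simp add: card_image)
      finally show "rk (K \<union> \<phi> ` X) = rk K + card (\<phi> ` X)" .
    qed
    finally show ?thesis .
  qed
  let ?U = "copies s (uniform 1 2)" and ?\<psi> = "inv_into G \<phi>"
  have groundU: "ground ?U = G" by (auto simp: copies_def direct_sum_def uniform_def G_def)
  have bij: "bij_betw ?\<psi> (\<phi> ` G) G" using inj by (intro bij_betw_inv_into) (simp add: bij_betw_def)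
  have "Z \<in> indeps N \<longleftrightarrow> ?\<psi> ` Z \<in> indeps ?U" if Z: "Z \<subseteq> \<phi> ` G" for Z
  proof -
    obtain X where X: "X \<subseteq> G" "Z = \<phi> ` X" using Z by (meson subset_imageE)
    have "?\<psi> ` Z = X" using X inj by (simp add: inv_into_image_cancel)
    moreover have "X \<in> indeps ?U \<longleftrightarrow> (\<forall>k<s. card (X `` {k}) \<le> 1)"
      using X(1) by (auto simp: copies_def direct_sum_def uniform_def G_def)
    ultimately show ?thesis using indep[OF X(1)] X(2) by simp
  qed
  then have "isomorphic N ?U"
    using bij N(2) groundU by (auto simp: isomorphic_def intro!: exI[of _ ?\<psi>])
  then show ?thesis using N(1) by (auto simp: has_minor_def)
qed

section \<open>The minor of loops and coloops\<close>

text \<open>Once \<open>F\<close> is contracted, its maximality makes every remaining element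
  outside \<open>B\<close> a loop. A basis of \<open>M\<close> extending \<open>F\<close> contains
  all but \<open>card F\<close> elements of \<open>B\<close>, since all bases have equal size. With
  the other elements of \<open>B\<close> deleted, those in this basis form the only basis of the
  minor.\<close>

lemma trivial_minor_exists:
  assumes B: "basis M B" and F: "basis_of M (ground M - B) F"
  shows "\<exists>N. is_minor N M \<and> int (card (ground M)) - int (card (ground N)) = 2 * int (card F) \<and>
    (\<forall>e\<in>ground N. loop N e \<or> coloop N e)"
proof -
  have Fi: "F \<in> indeps M" "F \<subseteq> ground M - B"
    and Fmax: "\<And>F'. F' \<in> indeps M \<Longrightarrow> F \<subseteq> F' \<Longrightarrow> F' \<subseteq> ground M - B \<Longrightarrow> F' = F"
    using F by (auto simp: basis_of_def)
  have Bi: "B \<in> indeps M" "B \<subseteq> ground M" using B by (auto simp: basis_of_def)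
  have "F \<subseteq> ground M" using Fi(2) by auto
  then obtain G where G: "basis M G" "F \<subseteq> G" using extend_to_basis[OF Fi(1)] by metis
  have Gi: "G \<in> indeps M" "G \<subseteq> ground M" using G by (auto simp: basis_of_def)
  have "G - B = F"
    by (rule Fmax) (use Gi G(2) Fi(2) indep_subset[OF Gi(1)] in auto)
  define C where "C = G \<inter> B"
  have GFC: "G = F \<union> C" "F \<inter> C = {}" using \<open>G - B = F\<close> by (auto simp: C_def)
  have fin: "finite B" "finite F" "finite C"
    using finite_indep Bi Fi by (auto simp: C_def)
  define D where "D = B - C"
  have "card G = card B" using G(1) B by (rule basis_of_card_eq)
  then have "card F + card C = card B" using GFC fin by (simp add: card_Un_disjoint)
  then have cardD: "card D = card F"
    using fin by (simp add: D_def C_def card_Diff_subset_Int Int_commute)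
  define N where "N = delete (contract M F) D"
  have minor: "is_minor N M"
    unfolding is_minor_def N_def using Fi Bi by (intro exI[of _ F] exI[of _ D]) (auto simp: D_def)
  have groundN: "ground N = ground M - (F \<union> D)"
    by (auto simp: N_def delete_def contract_def)
  have "card (ground N) = card (ground M) - card (F \<union> D)"
    using fin Fi Bi unfolding groundN by (intro card_Diff_subset) (auto simp: D_def)
  moreover have "card (F \<union> D) = 2 * card F"
    using fin Fi cardD by (subst card_Un_disjoint) (auto simp: D_def)
  moreover have "card (F \<union> D) \<le> card (ground M)"
    using Fi Bi finite_ground by (intro card_mono) (auto simp: D_def)
  ultimately have card: "int (card (ground M)) - int (card (ground N)) = 2 * int (card F)" by simp
  have basisF: "basis_of M F B' \<longleftrightarrow> B' = F" for B' using Fi(1) by (auto simp: basis_of_def)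
  have indepN: "X \<in> indeps N \<longleftrightarrow> X \<subseteq> ground N \<and> X \<union> F \<in> indeps M" for X
    by (auto simp: N_def delete_def contract_def basisF)
  have loops: "loop N e" if e: "e \<in> ground N" "e \<notin> B" for e
  proof -
    have "insert e F \<notin> indeps M"
      using Fmax[of "insert e F"] e Fi(2) by (auto simp: groundN)
    then show ?thesis using e(1) by (simp add: loop_def indepN)
  qed
  have CN: "C \<subseteq> ground N" using GFC Gi by (auto simp: groundN D_def)
  have "C \<in> indeps N" using CN GFC Gi by (simp add: indepN Un_commute)
  have coloops: "coloop N e" if e: "e \<in> ground N" "e \<in> B" for e
    unfolding coloop_def
  proof (intro conjI allI impI)
    fix B' assume B': "basis N B'"
    then have B'i: "B' \<in> indeps N" "B' \<subseteq> ground N" by (auto simp: basis_of_def)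
    have "B' \<subseteq> C"
    proof
      fix x assume x: "x \<in> B'"
      have "{x} \<union> F \<in> indeps M"
        using B'i(1) x indep_subset[of "B' \<union> F" "{x} \<union> F"] by (auto simp: indepN)
      then have "x \<in> B" using loops[of x] x B'i(2) by (auto simp: loop_def indepN)
      then show "x \<in> C" using x B'i(2) by (auto simp: groundN D_def)
    qed
    then have "C = B'" using B' \<open>C \<in> indeps N\<close> CN by (auto simp: basis_of_def)
    then show "e \<in> B'" using e by (auto simp: groundN D_def)
  qed (rule e(1))
  show ?thesis using minor card loops coloops by blast
qed

end

section \<open>The numerical bound and the conclusion\<close>

text \<open>The left side is the exponent of 4 demanded of \<open>card F\<close>; its summand 1 pays
  for the factor 2 in \<open>2 * card F\<close>. Bounding \<open>4 ^ s + s\<close> by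
  \<open>2 ^ (2 * s + 1)\<close> and \<open>s + 1\<close> by \<open>2 ^ s\<close> gives the exponent
  \<open>2 * s\<^sup>2 + 2 * s\<close> of 2, which is at most \<open>4 * s\<^sup>2\<close>.\<close>

lemma chain_length_bound: "s * (4 ^ s + s) ^ s + 1 \<le> (4::nat) ^ (2 * s\<^sup>2)"
proof -
  have "s + 1 \<le> 2 ^ s" by (simp add: Suc_le_eq)
  moreover have "(4::nat) ^ s = 2 ^ s * 2 ^ s" by (simp flip: power_mult_distrib)
  moreover have "(2::nat) ^ s * 1 \<le> 2 ^ s * 2 ^ s" by (intro mult_le_mono2) simp
  ultimately have "4 ^ s + s \<le> 2 * (4::nat) ^ s" by linarith
  also have "\<dots> = 2 ^ (2 * s + 1)" by (simp only: power_add power_mult) simp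
  finally have "(4 ^ s + s) ^ s \<le> (2 ^ (2 * s + 1)) ^ s" by (rule power_mono) simp
  also have "\<dots> = (2::nat) ^ ((2 * s + 1) * s)" by (rule power_mult[symmetric])
  finally have le: "(4 ^ s + s) ^ s \<le> (2::nat) ^ ((2 * s + 1) * s)" .
  have "s * (4 ^ s + s) ^ s + 1 \<le> s * 2 ^ ((2 * s + 1) * s) + 2 ^ ((2 * s + 1) * s)"
    using le by (intro add_mono mult_le_mono2) auto
  also have "\<dots> = (s + 1) * 2 ^ ((2 * s + 1) * s)" by simp
  also have "\<dots> \<le> 2 ^ s * 2 ^ ((2 * s + 1) * s)"
    using \<open>s + 1 \<le> 2 ^ s\<close> by (intro mult_le_mono1)
  also have "\<dots> = 2 ^ (s + (2 * s + 1) * s)" by (rule power_add[symmetric])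
  also have "\<dots> \<le> 2 ^ (2 * (2 * s\<^sup>2))"
    by (intro power_increasing) (auto simp: power2_eq_square algebra_simps)
  also have "\<dots> = (4::nat) ^ (2 * s\<^sup>2)" by (simp add: power_mult)
  finally show ?thesis .
qed

theorem theorem3p6:
  fixes s :: nat and M :: "'a pre_matroid"
  assumes "matroid M"
  shows "has_minor M (uniform s (2 * s))
    \<or> has_minor M (copies s (uniform 1 2))
    \<or> (\<exists>N. is_minor N M
          \<and> int (card (ground M)) - int (card (ground N)) \<le> 4 ^ (4 ^ (2 * s\<^sup>2))
          \<and> (\<forall>e\<in>ground N. loop N e \<or> coloop N e))"
proof -
  interpret matroid M by (rule assms)
  obtain B where B: "basis M B" using basis_of_exists by blast
  obtain F where F: "basis_of M (ground M - B) F" using basis_of_exists by blast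
  have Fi: "F \<in> indeps M" "F \<subseteq> ground M - B" using F by (auto simp: basis_of_def)
  have Bi: "B \<in> indeps M" using B by (auto simp: basis_of_def)
  have finF: "finite F" using Fi(1) by (rule finite_indep)
  let ?t = "(4 ^ s + s) ^ s"
  consider (small) "2 * card F \<le> 4 ^ (4 ^ (2 * s\<^sup>2))" | (uni) "has_minor M (uniform s (2 * s))"
    | (large) "4 ^ (4 ^ (2 * s\<^sup>2)) < 2 * card F" "\<not> has_minor M (uniform s (2 * s))"
    by linarith
  then show ?thesis
  proof cases
    case small
    then have "int (2 * card F) \<le> int (4 ^ (4 ^ (2 * s\<^sup>2)))" by (simp only: of_nat_le_iff)
    then have "2 * int (card F) \<le> 4 ^ (4 ^ (2 * s\<^sup>2))" by simp
    then show ?thesis using trivial_minor_exists[OF B F] by metis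
  next
    case uni
    then show ?thesis by simp
  next
    case large
    have "(4::nat) ^ (s * ?t + 1) \<le> 4 ^ (4 ^ (2 * s\<^sup>2))"
      using chain_length_bound by (rule power_increasing) simp
    then have card: "4 ^ (s * ?t) \<le> card F" using large(1) by simp
    obtain f where f: "bij_betw f {..<card F} F"
      using ex_bij_betw_nat_finite[OF finF] by (auto simp: atLeast0LessThan)
    have fF: "f ` {..<card F} = F" using f by (rule bij_betw_imp_surj_on)
    have indep: "\<forall>i\<in>{..<card F}. f i \<notin> cl (f ` ({..<card F} - {i}))"
    proof
      fix i assume i: "i \<in> {..<card F}"
      have "f ` ({..<card F} - {i}) = F - {f i}"
        using f i fF by (auto simp: bij_betw_def inj_on_def)
      moreover have "f i \<in> F" using i fF by auto
      ultimately show "f i \<notin> cl (f ` ({..<card F} - {i}))"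
        using notin_cl_of_rk_Un[OF finF, of "{}" "f i"] rk_indep[OF Fi(1)] by simp
    qed
    have span: "f ` {..<card F} \<subseteq> cl B"
      unfolding fF
    proof (rule subsetI, rule ccontr)
      fix e assume e: "e \<in> F" "e \<notin> cl B"
      have "basis_of M B B" using Bi by (auto simp: basis_of_def)
      then have "insert e B \<in> indeps M" using e(2) notin_cl_iff by auto
      moreover have "insert e B \<subseteq> ground M" using calculation by (rule indep_subset_ground)
      ultimately have "insert e B = B" using B unfolding basis_of_def by blast
      then show False using e(1) Fi(2) by blast
    qed
    have "f ` {..<card F} \<inter> B = {}" using fF Fi(2) by auto
    then have "\<exists>K b g. chain K b g {..<?t} \<and> K \<union> b ` {..<?t} \<subseteq> cl B"
      using card by (intro chain_exists[OF large(2) _ finite_indep[OF Bi] _ indep span]) auto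
    then obtain K b g where ch: "chain K b g {..<?t}" by (elim exE conjE)
    obtain K' I' where "I' \<subseteq> {..<?t}" "card I' = s" "chain K' b g I'"
      "\<forall>i\<in>I'. g i \<in> cl (insert (b i) K')"
      using matching_exists[OF large(2) _ ch, of s] by auto
    then have "has_minor M (copies s (uniform 1 2))"
      using finite_subset[of I' "{..<?t}"] by (intro has_minor_copiesI) auto
    then show ?thesis by simp
  qed
qed

end
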